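(* Let $\lambda$ be an infinite cardinal and assume the two-cardinal transfer principle $\langle\aleph_0,\aleph_1\rangle\rightarrow\langle\lambda,\lambda^+\rangle$ (defined in the context). Let $L$ be a first-order vocabulary with $|L|\le\lambda$, let $M$ be an $L$-structure of cardinality at most $\lambda^+$ (a model of some first-order theory $T$), and let $N$ be an $L$-structure. Let $\Delta$ be a set of first-order $L$-formulas and let $D$ be a regular filter on $\lambda$. Suppose every weakly $\Delta$-existential sentence true in $M$ is also true in $N$. Then there is a $\Delta$-embedding of $M$ into the reduced power $N^{\lambda}/D$.
   Context: The principle $\langle\aleph_0,\aleph_1\rangle\rightarrow\langle\lambda,\lambda^+\rangle$ is the two-cardinal transfer statement: for every first-order theory $T'$ in a countable vocabulary containing a unary predicate $U$, if $T'$ has a model $A$ with $|A|=\aleph_1$ and $|U^A|=\aleph_0$, then $T'$ has a model $B$ with $|B|=\lambda^+$ and $|U^B|=\lambda$. (It follows from $\lambda^{<\lambda}=\lambda$ by Chang's two-cardinal theorem.) A filter $D$ on $\lambda$ is regular if there is a family $\{A_\alpha:\alpha<\lambda\}\subseteq D$ such that every $i<\lambda$ belongs to only finitely many $A_\alpha$. A $\Delta$-existential formula is one of the form $\exists x_1\dots\exists x_n(\phi_1\wedge\dots\wedge\phi_n)$ with each $\phi_i\in\Delta$; it is weakly $\Delta$-existential if each $\phi_i$ is either in $\Delta$ or the negation of a formula in $\Delta$. A map $h:M\to N'$ is a $\Delta$-homomorphism if it preserves truth of formulas in $\Delta$ (for all tuples), and a $\Delta$-embedding if it also preserves truth of negations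 of formulas in $\Delta$. $N^\lambda/D$ is the reduced power of $N$ modulo $D$.
   Formalization: Truth of a Δ-formula in N^λ/D is read as truth in N for D-almost all indices; literal truth in N^λ/D is claimed only for formulas where a.e. truth of it and of its negation passes to N^λ/D (e.g. atomic, or D an ultrafilter). Literally false: |M|=|N|=2, Δ says "exactly two elements". *)

theory Defs
  imports Complex_Main "HOL-Library.FuncSet"
begin

unbundle cardinal_syntax

section \<open>First-order logic\<close>

record ('f, 'r) vocabulary =
  fun_syms :: "'f set"
  rel_syms :: "'r set"
  fun_arity :: "'f \<Rightarrow> nat"
  rel_arity :: "'r \<Rightarrow> nat"

text \<open>Variables are de Bruijn indices: \<open>Exists\<close> binds index \<open>0\<close> of its body.\<close>

datatype 'f tm = Var nat | Fn 'f "'f tm list"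

datatype ('f, 'r) fm =
    Eq "'f tm" "'f tm"
  | Rel 'r "'f tm list"
  | Neg "('f, 'r) fm"
  | And "('f, 'r) fm" "('f, 'r) fm"
  | Exists "('f, 'r) fm"

primrec term_in :: "('f, 'r) vocabulary \<Rightarrow> 'f tm \<Rightarrow> bool" where
  "term_in L (Var n) \<longleftrightarrow> True"
| "term_in L (Fn f ts) \<longleftrightarrow>
     f \<in> fun_syms L \<and> length ts = fun_arity L f \<and> list_all (term_in L) ts"

primrec formula_in :: "('f, 'r) vocabulary \<Rightarrow> ('f, 'r) fm \<Rightarrow> bool" where
  "formula_in L (Eq s t) \<longleftrightarrow> term_in L s \<and> term_in L t"
| "formula_in L (Rel r ts) \<longleftrightarrow>
     r \<in> rel_syms L \<and> length ts = rel_arity L r \<and> (\<forall>t\<in>set ts. term_in L t)"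
| "formula_in L (Neg \<phi>) \<longleftrightarrow> formula_in L \<phi>"
| "formula_in L (And \<phi> \<psi>) \<longleftrightarrow> formula_in L \<phi> \<and> formula_in L \<psi>"
| "formula_in L (Exists \<phi>) \<longleftrightarrow> formula_in L \<phi>"

primrec term_vars :: "'f tm \<Rightarrow> nat set" where
  "term_vars (Var n) = {n}"
| "term_vars (Fn f ts) = \<Union> (set (map term_vars ts))"

primrec free_vars :: "('f, 'r) fm \<Rightarrow> nat set" where
  "free_vars (Eq s t) = term_vars s \<union> term_vars t"
| "free_vars (Rel r ts) = (\<Union>t\<in>set ts. term_vars t)"
| "free_vars (Neg \<phi>) = free_vars \<phi>"
| "free_vars (And \<phi> \<psi>) = free_vars \<phi> \<union> free_vars \<psi>"
| "free_vars (Exists \<phi>) = {n. Suc n \<in> free_vars \<phi>}"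

definition sentence :: "('f, 'r) vocabulary \<Rightarrow> ('f, 'r) fm \<Rightarrow> bool" where
  "sentence L \<phi> \<longleftrightarrow> formula_in L \<phi> \<and> free_vars \<phi> = {}"

record ('a, 'f, 'r) struct =
  universe :: "'a set"
  fun_int :: "'f \<Rightarrow> 'a list \<Rightarrow> 'a"
  rel_int :: "'r \<Rightarrow> 'a list \<Rightarrow> bool"

definition structure_of :: "('f, 'r) vocabulary \<Rightarrow> ('a, 'f, 'r) struct \<Rightarrow> bool" where
  "structure_of L M \<longleftrightarrow> universe M \<noteq> {} \<and>
     (\<forall>f\<in>fun_syms L. \<forall>xs. length xs = fun_arity L f \<longrightarrow> set xs \<subseteq> universe M \<longrightarrow>
        fun_int M f xs \<in> universe M)"

primrec eval_tm :: "('a, 'f, 'r) struct \<Rightarrow> (nat \<Rightarrow> 'a) \<Rightarrow> 'f tm \<Rightarrow> 'a" where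
  "eval_tm M e (Var n) = e n"
| "eval_tm M e (Fn f ts) = fun_int M f (map (eval_tm M e) ts)"

primrec sat :: "('a, 'f, 'r) struct \<Rightarrow> (nat \<Rightarrow> 'a) \<Rightarrow> ('f, 'r) fm \<Rightarrow> bool" where
  "sat M e (Eq s t) \<longleftrightarrow> eval_tm M e s = eval_tm M e t"
| "sat M e (Rel r ts) \<longleftrightarrow> rel_int M r (map (eval_tm M e) ts)"
| "sat M e (Neg \<phi>) \<longleftrightarrow> \<not> sat M e \<phi>"
| "sat M e (And \<phi> \<psi>) \<longleftrightarrow> sat M e \<phi> \<and> sat M e \<psi>"
| "sat M e (Exists \<phi>) \<longleftrightarrow> (\<exists>a\<in>universe M. sat M (case_nat a e) \<phi>)"

definition true_in :: "('a, 'f, 'r) struct \<Rightarrow> ('f, 'r) fm \<Rightarrow> bool" where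
  "true_in M \<phi> \<longleftrightarrow> (\<forall>e. range e \<subseteq> universe M \<longrightarrow> sat M e \<phi>)"

definition theory_in :: "('f, 'r) vocabulary \<Rightarrow> ('f, 'r) fm set \<Rightarrow> bool" where
  "theory_in L T \<longleftrightarrow> (\<forall>\<phi>\<in>T. sentence L \<phi>)"

definition model_of ::
    "('f, 'r) vocabulary \<Rightarrow> ('f, 'r) fm set \<Rightarrow> ('a, 'f, 'r) struct \<Rightarrow> bool" where
  "model_of L T M \<longleftrightarrow> structure_of L M \<and> (\<forall>\<phi>\<in>T. true_in M \<phi>)"

section \<open>The two-cardinal transfer principle\<close>

text \<open>
  Every countable vocabulary is, up to renaming, one with symbols in \<open>nat\<close>. Up to isomorphism,
  a structure of cardinality \<open>\<aleph>\<^sub>1\<close> has its universe in \<open>nat set\<close>, the type over which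
  \<open>cardSuc natLeq\<close> is defined, and one of cardinality \<open>\<lambda>\<^sup>+\<close> has its universe in
  \<open>'i set\<close>. Hence no generality is lost by fixing these types.
\<close>

definition two_cardinal_transfer :: "'i rel \<Rightarrow> bool" where
  "two_cardinal_transfer lam \<longleftrightarrow>
     (\<forall>(L :: (nat, nat) vocabulary) U T.
        U \<in> rel_syms L \<and> rel_arity L U = 1 \<and> theory_in L T \<and>
        (\<exists>A :: (nat set, nat, nat) struct. model_of L T A \<and>
           |universe A| =o cardSuc natLeq \<and>
           |{a \<in> universe A. rel_int A U [a]}| =o natLeq) \<longrightarrow>
        (\<exists>B :: ('i set, nat, nat) struct. model_of L T B \<and>
           |universe B| =o cardSuc lam \<and>
           |{b \<in> universe B. rel_int B U [b]}| =o lam))"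

section \<open>Weakly \<open>\<Delta>\<close>-existential formulas\<close>

primrec rename_tm :: "(nat \<Rightarrow> nat) \<Rightarrow> 'f tm \<Rightarrow> 'f tm" where
  "rename_tm \<sigma> (Var n) = Var (\<sigma> n)"
| "rename_tm \<sigma> (Fn f ts) = Fn f (map (rename_tm \<sigma>) ts)"

primrec rename :: "(nat \<Rightarrow> nat) \<Rightarrow> ('f, 'r) fm \<Rightarrow> ('f, 'r) fm" where
  "rename \<sigma> (Eq s t) = Eq (rename_tm \<sigma> s) (rename_tm \<sigma> t)"
| "rename \<sigma> (Rel r ts) = Rel r (map (rename_tm \<sigma>) ts)"
| "rename \<sigma> (Neg \<phi>) = Neg (rename \<sigma> \<phi>)"
| "rename \<sigma> (And \<phi> \<psi>) = And (rename \<sigma> \<phi>) (rename \<sigma> \<psi>)"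
| "rename \<sigma> (Exists \<phi>) = Exists (rename (case_nat 0 (\<lambda>n. Suc (\<sigma> n))) \<phi>)"

text \<open>
  Membership of \<open>\<phi>(x\<^sub>1, \<dots>, x\<^sub>k)\<close> in \<open>\<Delta>\<close> does not depend on which variables are displayed: the
  conjuncts of a \<open>\<Delta>\<close>-existential formula may be any \<open>\<phi>(y\<^sub>1, \<dots>, y\<^sub>k)\<close>, where the \<open>y\<^sub>j\<close> are
  variables, possibly repeated. For example, with \<open>R(x, y)\<close> in \<open>\<Delta>\<close> the formula
  \<open>\<exists>x y z. R(x, y) \<and> R(y, z)\<close> is \<open>\<Delta>\<close>-existential. Correspondingly, homomorphisms preserve
  \<open>\<Delta>\<close> for all tuples, including those with repetitions.
\<close>

definition instances :: "('f, 'r) fm set \<Rightarrow> ('f, 'r) fm set" where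
  "instances \<Delta> = {rename \<sigma> \<phi> | \<sigma> \<phi>. \<phi> \<in> \<Delta>}"

definition weakly_existential :: "('f, 'r) fm set \<Rightarrow> ('f, 'r) fm set" where
  "weakly_existential \<Delta> =
     {(Exists ^^ n) (foldr And \<phi>s \<phi>) | n \<phi>s \<phi>.
        \<forall>\<psi>\<in>set (\<phi> # \<phi>s). \<psi> \<in> instances \<Delta> \<or> \<psi> \<in> Neg ` instances \<Delta>}"

section \<open>Reduced powers\<close>

definition regular_filter :: "'i filter \<Rightarrow> bool" where
  "regular_filter D \<longleftrightarrow>
     (\<exists>A :: 'i \<Rightarrow> 'i set.
        (\<forall>\<alpha>. eventually (\<lambda>i. i \<in> A \<alpha>) D) \<and> (\<forall>i. finite {\<alpha>. i \<in> A \<alpha>}))"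

definition ae_eq :: "'i filter \<Rightarrow> 'a set \<Rightarrow> (('i \<Rightarrow> 'a) \<times> ('i \<Rightarrow> 'a)) set" where
  "ae_eq D X = {(f, g). f \<in> UNIV \<rightarrow> X \<and> g \<in> UNIV \<rightarrow> X \<and> eventually (\<lambda>i. f i = g i) D}"

definition rep :: "('i \<Rightarrow> 'a) set \<Rightarrow> 'i \<Rightarrow> 'a" where
  "rep F = (SOME f. f \<in> F)"

definition reduced_power ::
    "'i filter \<Rightarrow> ('a, 'f, 'r) struct \<Rightarrow> (('i \<Rightarrow> 'a) set, 'f, 'r) struct" where
  "reduced_power D N =
     \<lparr>universe = (UNIV \<rightarrow> universe N) // ae_eq D (universe N),
      fun_int = (\<lambda>f Fs. ae_eq D (universe N) `` {\<lambda>i. fun_int N f (map (\<lambda>F. rep F i) Fs)}),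
      rel_int = (\<lambda>r Fs. eventually (\<lambda>i. rel_int N r (map (\<lambda>F. rep F i) Fs)) D)\<rparr>"

text \<open>
  The two readings of truth of a formula \<open>\<phi>([f\<^sub>1], \<dots>, [f\<^sub>k])\<close> in a reduced power:
  \<open>sat (reduced_power D N)\<close> is satisfaction in the quotient structure, whereas \<open>ae_sat D N\<close>
  says that \<open>{i. N \<Turnstile> \<phi>(f\<^sub>1(i), \<dots>, f\<^sub>k(i))}\<close> belongs to \<open>D\<close>.
\<close>

definition ae_sat ::
    "'i filter \<Rightarrow> ('a, 'f, 'r) struct \<Rightarrow> (nat \<Rightarrow> ('i \<Rightarrow> 'a) set) \<Rightarrow> ('f, 'r) fm \<Rightarrow> bool" where
  "ae_sat D N e \<phi> \<longleftrightarrow> eventually (\<lambda>i. sat N (\<lambda>n. rep (e n) i) \<phi>) D"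

definition transfers :: "'i filter \<Rightarrow> ('a, 'f, 'r) struct \<Rightarrow> ('f, 'r) fm \<Rightarrow> bool" where
  "transfers D N \<phi> \<longleftrightarrow>
     (\<forall>e. range e \<subseteq> universe (reduced_power D N) \<longrightarrow> ae_sat D N e \<phi> \<longrightarrow>
        sat (reduced_power D N) e \<phi>)"

text \<open>
  The formulas \<open>\<phi>\<close> for which a.e. truth of \<open>\<phi>\<close> and of \<open>\<not> \<phi>\<close> implies their truth in the quotient
  structure. As shown below, every atomic formula is one, and every formula is one if \<open>D\<close> is an
  ultrafilter. For a filter \<open>D\<close> that is not an ultrafilter it can fail: if \<open>\<phi>\<close> says that there
  are exactly two elements and \<open>N\<close> has exactly two elements, then \<open>\<phi>\<close> holds in \<open>N\<close> and not in
  \<open>reduced_power D N\<close>.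
\<close>

definition los_formulas :: "'i filter \<Rightarrow> ('a, 'f, 'r) struct \<Rightarrow> ('f, 'r) fm set" where
  "los_formulas D N = {\<phi>. transfers D N \<phi> \<and> transfers D N (Neg \<phi>)}"

section \<open>\<open>\<Delta>\<close>-embeddings\<close>

text \<open>
  The satisfaction relations of source and target are parameters, so that the same notion applies
  to both readings of truth in a reduced power. Assignments \<open>e\<close> play the role of tuples.
\<close>

definition delta_homomorphism ::
    "('f, 'r) fm set \<Rightarrow> 'a set \<Rightarrow> ((nat \<Rightarrow> 'a) \<Rightarrow> ('f, 'r) fm \<Rightarrow> bool) \<Rightarrow>
     'b set \<Rightarrow> ((nat \<Rightarrow> 'b) \<Rightarrow> ('f, 'r) fm \<Rightarrow> bool) \<Rightarrow> ('a \<Rightarrow> 'b) \<Rightarrow> bool" where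
  "delta_homomorphism \<Delta> X satX Y satY h \<longleftrightarrow>
     h \<in> X \<rightarrow> Y \<and>
     (\<forall>\<phi>\<in>\<Delta>. \<forall>e. range e \<subseteq> X \<longrightarrow> satX e \<phi> \<longrightarrow> satY (h \<circ> e) \<phi>)"

definition delta_embedding ::
    "('f, 'r) fm set \<Rightarrow> 'a set \<Rightarrow> ((nat \<Rightarrow> 'a) \<Rightarrow> ('f, 'r) fm \<Rightarrow> bool) \<Rightarrow>
     'b set \<Rightarrow> ((nat \<Rightarrow> 'b) \<Rightarrow> ('f, 'r) fm \<Rightarrow> bool) \<Rightarrow> ('a \<Rightarrow> 'b) \<Rightarrow> bool" where
  "delta_embedding \<Delta> X satX Y satY h \<longleftrightarrow>
     delta_homomorphism \<Delta> X satX Y satY h \<and> delta_homomorphism (Neg ` \<Delta>) X satX Y satY h"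

section \<open>The fundamental facts on truth in reduced powers\<close>

lemma equiv_ae_eq:
  fixes D :: "'i filter" and X :: "'a set"
  shows "equiv (UNIV \<rightarrow> X) (ae_eq D X)"
proof (rule equivI)
  show "ae_eq D X \<subseteq> (UNIV \<rightarrow> X) \<times> (UNIV \<rightarrow> X)" by (auto simp: ae_eq_def)
  show "refl_on (UNIV \<rightarrow> X) (ae_eq D X)" by (auto simp: refl_on_def ae_eq_def)
  show "sym (ae_eq D X)" by (simp add: sym_def ae_eq_def eq_commute)
  have "eventually (\<lambda>i. f i = h i) D"
    if "eventually (\<lambda>i. f i = g i) D" "eventually (\<lambda>i. g i = h i) D" for f g h :: "'i \<Rightarrow> 'a"
    using that by eventually_elim simp
  then show "trans (ae_eq D X)"
    unfolding trans_def ae_eq_def by blast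
qed

lemma universe_reduced_power:
  "universe (reduced_power D N) = (UNIV \<rightarrow> universe N) // ae_eq D (universe N)"
  by (simp add: reduced_power_def)

lemma rep_in:
  assumes "F \<in> universe (reduced_power D N)"
  shows "rep F \<in> F" "rep F i \<in> universe N" "ae_eq D (universe N) `` {rep F} = F"
proof -
  have q: "F \<in> (UNIV \<rightarrow> universe N) // ae_eq D (universe N)"
    using assms by (simp add: universe_reduced_power)
  obtain f where f: "f \<in> UNIV \<rightarrow> universe N" "F = ae_eq D (universe N) `` {f}"
    using q by (rule quotientE)
  have "f \<in> F" using f by (simp add: ae_eq_def)
  then show r: "rep F \<in> F" unfolding rep_def by (rule someI[of "\<lambda>f. f \<in> F"])
  then have fr: "(f, rep F) \<in> ae_eq D (universe N)" unfolding f(2) by simp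
  then show "rep F i \<in> universe N" by (auto simp: ae_eq_def)
  show "ae_eq D (universe N) `` {rep F} = F"
    using equiv_class_eq[OF equiv_ae_eq fr] f(2) by simp
qed

lemma class_in:
  assumes "\<And>i. g i \<in> universe N"
  shows "ae_eq D (universe N) `` {g} \<in> universe (reduced_power D N)"
    "eventually (\<lambda>i. rep (ae_eq D (universe N) `` {g}) i = g i) D"
proof -
  show 1: "ae_eq D (universe N) `` {g} \<in> universe (reduced_power D N)"
    using assms by (auto simp: universe_reduced_power intro: quotientI)
  show "eventually (\<lambda>i. rep (ae_eq D (universe N) `` {g}) i = g i) D"
  proof -
    have "(g, rep (ae_eq D (universe N) `` {g})) \<in> ae_eq D (universe N)"
      using rep_in(1)[OF 1] by (rule Image_singleton_iff[THEN iffD1])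
    then have "eventually (\<lambda>i. g i = rep (ae_eq D (universe N) `` {g}) i) D"
      unfolding ae_eq_def by blast
    then show ?thesis by (rule eventually_mono) (rule sym)
  qed
qed

lemma class_eq_iff:
  assumes "F \<in> universe (reduced_power D N)" "G \<in> universe (reduced_power D N)"
  shows "F = G \<longleftrightarrow> eventually (\<lambda>i. rep F i = rep G i) D"
proof
  assume "eventually (\<lambda>i. rep F i = rep G i) D"
  then have "(rep F, rep G) \<in> ae_eq D (universe N)"
    using rep_in(2)[OF assms(1)] rep_in(2)[OF assms(2)] by (auto simp: ae_eq_def)
  then show "F = G"
    using rep_in(3)[OF assms(1)] rep_in(3)[OF assms(2)]
    by (metis equiv_ae_eq equiv_class_eq)
qed simp

lemma map_rep_eval:
  assumes "\<forall>t\<in>set ts. eventually (\<lambda>i. rep (E t) i = V i t) D"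
  shows "eventually (\<lambda>i. map (\<lambda>F. rep F i) (map E ts) = map (V i) ts) D"
proof -
  have "eventually (\<lambda>i. \<forall>t\<in>set ts. rep (E t) i = V i t) D"
    using assms by (simp add: eventually_ball_finite)
  then show ?thesis by (rule eventually_mono) auto
qed

lemma eval_tm_reduced_power:
  assumes N: "structure_of L N" and e: "range e \<subseteq> universe (reduced_power D N)"
    and "term_in L t"
  shows "eval_tm (reduced_power D N) e t \<in> universe (reduced_power D N) \<and>
    eventually (\<lambda>i. rep (eval_tm (reduced_power D N) e t) i = eval_tm N (\<lambda>n. rep (e n) i) t) D"
  using assms(3)
proof (induction t)
  case (Var n)
  then show ?case using e by auto
next
  case (Fn f ts)
  let ?R = "reduced_power D N"
  let ?g = "\<lambda>i. fun_int N f (map (\<lambda>F. rep F i) (map (eval_tm ?R e) ts))"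
  have IH: "eval_tm ?R e t \<in> universe ?R"
      "eventually (\<lambda>i. rep (eval_tm ?R e t) i = eval_tm N (\<lambda>n. rep (e n) i) t) D"
    if "t \<in> set ts" for t
    using Fn that by (auto simp: list_all_iff)
  have g: "?g i \<in> universe N" for i
  proof -
    have "set (map (\<lambda>F. rep F i) (map (eval_tm ?R e) ts)) \<subseteq> universe N"
      using IH(1) rep_in(2)[of _ D N] by auto
    then show ?thesis
      using N Fn.prems unfolding structure_of_def by simp
  qed
  have ev: "eval_tm ?R e (Fn f ts) = ae_eq D (universe N) `` {?g}"
    by (simp add: reduced_power_def)
  have "eventually (\<lambda>i. ?g i = eval_tm N (\<lambda>n. rep (e n) i) (Fn f ts)) D"
  proof -
    have "eventually (\<lambda>i. map (\<lambda>F. rep F i) (map (eval_tm ?R e) ts) =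
        map (eval_tm N (\<lambda>n. rep (e n) i)) ts) D"
      by (rule map_rep_eval) (use IH(2) in auto)
    then show ?thesis
      by (rule eventually_mono) (simp only: eval_tm.simps)
  qed
  then show ?case
    unfolding ev using class_in(1)[of ?g N D, OF g] eventually_elim2[OF class_in(2)[of ?g N D, OF g]]
    by simp
qed

lemma atomic_iff_ae_sat:
  assumes N: "structure_of L N" and e: "range e \<subseteq> universe (reduced_power D N)"
    and \<phi>: "formula_in L \<phi>" "(\<exists>s t. \<phi> = Eq s t) \<or> (\<exists>r ts. \<phi> = Rel r ts)"
  shows "sat (reduced_power D N) e \<phi> \<longleftrightarrow> ae_sat D N e \<phi>"
proof -
  let ?R = "reduced_power D N"
  note ev = eval_tm_reduced_power[OF N e]
  have ?thesis if eq: "\<phi> = Eq s t" for s t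
  proof -
    have "sat ?R e \<phi> \<longleftrightarrow> eventually (\<lambda>i. rep (eval_tm ?R e s) i = rep (eval_tm ?R e t) i) D"
      using ev[of s] ev[of t] \<phi>(1) eq class_eq_iff[of "eval_tm ?R e s" D N] by simp
    also have "\<dots> \<longleftrightarrow> ae_sat D N e \<phi>"
      unfolding ae_sat_def eq
      by (rule eventually_cong[OF eventually_conj[OF ev[of s, THEN conjunct2] ev[of t, THEN conjunct2]]])
        (use \<phi>(1) eq in auto)
    finally show ?thesis .
  qed
  moreover have ?thesis if eq: "\<phi> = Rel r ts" for r ts
  proof -
    have "eventually (\<lambda>i. map (\<lambda>F. rep F i) (map (eval_tm ?R e) ts) =
        map (eval_tm N (\<lambda>n. rep (e n) i)) ts) D"
      by (rule map_rep_eval) (use ev \<phi>(1) eq in auto)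
    then have "eventually (\<lambda>i. rel_int N r (map (\<lambda>F. rep F i) (map (eval_tm ?R e) ts))) D \<longleftrightarrow>
        eventually (\<lambda>i. rel_int N r (map (eval_tm N (\<lambda>n. rep (e n) i)) ts)) D"
      by (rule eventually_cong) (simp only:)
    then show ?thesis
      unfolding ae_sat_def eq sat.simps by (simp add: reduced_power_def)
  qed
  ultimately show ?thesis using \<phi>(2) by blast
qed

lemma not_ae_sat_Neg:
  assumes "D \<noteq> bot" "ae_sat D N e (Neg \<phi>)"
  shows "\<not> ae_sat D N e \<phi>"
proof
  assume "ae_sat D N e \<phi>"
  with assms(2) have "eventually (\<lambda>i. False) D"
    unfolding ae_sat_def by eventually_elim simp
  with assms(1) show False by simp
qed

lemma atomic_los:
  assumes "structure_of L N" "D \<noteq> bot" "formula_in L \<phi>"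
    and "(\<exists>s t. \<phi> = Eq s t) \<or> (\<exists>r ts. \<phi> = Rel r ts)"
  shows "\<phi> \<in> los_formulas D N"
proof -
  have "transfers D N \<phi>"
    unfolding transfers_def using atomic_iff_ae_sat[OF assms(1) _ assms(3,4)] by blast
  moreover have "transfers D N (Neg \<phi>)"
    unfolding transfers_def sat.simps
    using atomic_iff_ae_sat[OF assms(1) _ assms(3,4)] not_ae_sat_Neg[OF assms(2)] by blast
  ultimately show ?thesis by (simp add: los_formulas_def)
qed

lemma ultrafilter_iff_ae_sat:
  assumes N: "structure_of L N" and "D \<noteq> bot"
    and ultra: "\<And>P. eventually P D \<or> eventually (\<lambda>i. \<not> P i) D"
    and "formula_in L \<phi>" "range e \<subseteq> universe (reduced_power D N)"
  shows "sat (reduced_power D N) e \<phi> \<longleftrightarrow> ae_sat D N e \<phi>"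
  using assms(4,5)
proof (induction \<phi> arbitrary: e)
  case (Eq s t)
  then show ?case by (intro atomic_iff_ae_sat[OF N]) simp_all
next
  case (Rel r ts)
  then show ?case by (intro atomic_iff_ae_sat[OF N]) simp_all
next
  case (Neg \<phi>)
  have "ae_sat D N e (Neg \<phi>) \<longleftrightarrow> \<not> ae_sat D N e \<phi>"
  proof
    assume "ae_sat D N e (Neg \<phi>)"
    then show "\<not> ae_sat D N e \<phi>" by (rule not_ae_sat_Neg[OF assms(2)])
  next
    assume "\<not> ae_sat D N e \<phi>"
    then show "ae_sat D N e (Neg \<phi>)"
      using ultra[of "\<lambda>i. sat N (\<lambda>n. rep (e n) i) \<phi>"] by (simp add: ae_sat_def)
  qed
  then show ?case using Neg by simp
next
  case (And \<phi> \<psi>)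
  then show ?case by (simp add: ae_sat_def eventually_conj_iff)
next
  case (Exists \<phi>)
  let ?R = "reduced_power D N"
  have r: "range (case_nat F e) \<subseteq> universe ?R" if "F \<in> universe ?R" for F
    using that Exists.prems by (auto simp: image_subset_iff split: nat.splits)
  have IH: "sat ?R (case_nat F e) \<phi> \<longleftrightarrow>
      eventually (\<lambda>i. sat N (case_nat (rep F i) (\<lambda>n. rep (e n) i)) \<phi>) D"
    if "F \<in> universe ?R" for F
  proof -
    have "(\<lambda>n. rep (case_nat F e n) i) = case_nat (rep F i) (\<lambda>n. rep (e n) i)" for i
      by (auto split: nat.split)
    then show ?thesis using Exists.IH[OF _ r[OF that]] Exists.prems by (simp add: ae_sat_def)
  qed
  show ?case
  proof
    assume "sat ?R e (Exists \<phi>)"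
    then obtain F where F: "F \<in> universe ?R" "sat ?R (case_nat F e) \<phi>" by auto
    then have "eventually (\<lambda>i. sat N (case_nat (rep F i) (\<lambda>n. rep (e n) i)) \<phi>) D"
      using IH by simp
    then show "ae_sat D N e (Exists \<phi>)"
      unfolding ae_sat_def by (rule eventually_mono) (use rep_in(2)[OF F(1)] in auto)
  next
    assume ae: "ae_sat D N e (Exists \<phi>)"
    obtain b where b: "b \<in> universe N" using N by (auto simp: structure_of_def)
    define P where "P = (\<lambda>i a. a \<in> universe N \<and> sat N (case_nat a (\<lambda>n. rep (e n) i)) \<phi>)"
    define g where "g = (\<lambda>i. if \<exists>a. P i a then SOME a. P i a else b)"
    have P: "P i (g i)" if "\<exists>a. P i a" for i
      using someI_ex[OF that] that by (simp add: g_def)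
    have g: "g i \<in> universe N" for i
      using P[of i] b by (cases "\<exists>a. P i a") (auto simp: P_def g_def)
    let ?F = "ae_eq D (universe N) `` {g}"
    have "eventually (\<lambda>i. \<exists>a. P i a) D"
      using ae unfolding ae_sat_def by (rule eventually_mono) (auto simp: P_def)
    then have "eventually (\<lambda>i. sat N (case_nat (rep ?F i) (\<lambda>n. rep (e n) i)) \<phi>) D"
      using class_in(2)[of g N D, OF g]
    proof eventually_elim
      case (elim i)
      then show ?case using P[of i] by (simp add: P_def)
    qed
    then show "sat ?R e (Exists \<phi>)"
      using IH[of ?F] class_in(1)[of g N D, OF g] by auto
  qed
qed

lemma ultrafilter_los:
  assumes "structure_of L N" "D \<noteq> bot"
    and "\<And>P. eventually P D \<or> eventually (\<lambda>i. \<not> P i) D"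
    and "formula_in L \<phi>"
  shows "\<phi> \<in> los_formulas D N"
proof -
  have "formula_in L (Neg \<phi>)" using assms(4) by simp
  note iff = ultrafilter_iff_ae_sat[OF assms(1-3) assms(4)]
    ultrafilter_iff_ae_sat[OF assms(1-3) this]
  show ?thesis
    unfolding los_formulas_def transfers_def by (simp add: iff del: sat.simps)
qed

end

theory Submission
  imports Defs "HOL-Library.Countable_Set_Type" "HOL-Library.Nat_Bijection"
begin

text \<open>
  On a set \<open>I\<close> of cardinality \<open>\<aleph>\<^sub>1\<close> there is an increasing sequence of forest orders with finite branches
  such that any two points are comparable in one of them (Todorcevic's \<open>\<rho>\<close>-function). Together with
  labels for the isomorphism types of the branches this is a structure with \<open>\<aleph>\<^sub>0\<close> many stages and
  labels, and the properties needed of it are first-order. Hence the transfer principle yields such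
  a system on a set of cardinality \<open>\<lambda>\<^sup>+\<close> with \<open>\<lambda>\<close> many stages and labels.

  There branches may be infinite, but for a finite set \<open>S\<close> of stages and labels the comparabilities
  at stages in \<open>S\<close> between points with labels in \<open>S\<close> generate a forest of finite height, because
  a label occurs only once on a branch. A regular filter assigns to each index \<open>i\<close> a finite set
  \<open>S i\<close> of stages and labels and a finite set \<open>F i\<close> of formulas of \<open>\<Delta>\<close> such that each stage, label and
  formula is caught almost everywhere. Index \<open>M\<close> by points of \<open>I\<close>. Since the height is finite,
  only finitely many game types with respect to \<open>F i\<close> matter; so, going up the forest of \<open>i\<close>,
  \<open>M\<close> can be copied into a finite subset of \<open>M\<close> preserving \<open>F i\<close> on every branch. A single weakly
  existential sentence maps this subset to \<open>N\<close>. Any finitely many points lie on one branch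
  for almost all \<open>i\<close>, so the resulting functions define the embedding into the reduced power.
\<close>

section \<open>Syntax and finite partial maps\<close>

lemma finite_free_vars: "finite (free_vars \<phi>)"
proof (induction \<phi>)
  case (Eq s t)
  have "finite (term_vars t)" for t :: "'a tm" by (induction t) auto
  then show ?case by simp
next
  case (Rel r ts)
  have "finite (term_vars t)" for t :: "'a tm" by (induction t) auto
  then show ?case by simp
next
  case (Exists \<phi>)
  have "{n. Suc n \<in> free_vars \<phi>} = Suc -` free_vars \<phi>" by auto
  then show ?case using Exists by (simp add: finite_vimageI)
qed auto

lemma eval_tm_cong: "(\<And>n. n \<in> term_vars t \<Longrightarrow> e n = e' n) \<Longrightarrow> eval_tm M e t = eval_tm M e' t"
proof (induction t)
  case (Fn f ts)
  then have "map (eval_tm M e) ts = map (eval_tm M e') ts" by (auto intro!: Fn.IH)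
  then show ?case by (simp only: eval_tm.simps)
qed simp

lemma sat_cong:
  assumes "\<And>n. n \<in> free_vars \<phi> \<Longrightarrow> e n = e' n"
  shows "sat M e \<phi> \<longleftrightarrow> sat M e' \<phi>"
  using assms
proof (induction \<phi> arbitrary: e e')
  case (Eq s t)
  then show ?case using eval_tm_cong[of s e e' M] eval_tm_cong[of t e e' M] by simp
next
  case (Rel r ts)
  then have "map (eval_tm M e) ts = map (eval_tm M e') ts" by (auto intro!: eval_tm_cong)
  then show ?case by (simp only: sat.simps)
next
  case (Exists \<phi>)
  have "sat M (case_nat a e) \<phi> \<longleftrightarrow> sat M (case_nat a e') \<phi>" for a
    by (rule Exists.IH) (use Exists.prems in \<open>auto split: nat.split\<close>)
  then show ?case by simp
next
  case (And \<phi> \<psi>)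
  have "sat M e \<phi> \<longleftrightarrow> sat M e' \<phi>" "sat M e \<psi> \<longleftrightarrow> sat M e' \<psi>"
    by (rule And.IH, use And.prems in simp)+
  then show ?case by simp
next
  case (Neg \<phi>)
  have "sat M e \<phi> \<longleftrightarrow> sat M e' \<phi>" by (rule Neg.IH, use Neg.prems in simp)
  then show ?case by simp
qed

lemma eval_tm_rename: "eval_tm M e (rename_tm \<sigma> t) = eval_tm M (e \<circ> \<sigma>) t"
  by (induction t) (auto intro!: arg_cong[where f = "fun_int M _"] simp: o_def)

lemma sat_rename: "sat M e (rename \<sigma> \<phi>) \<longleftrightarrow> sat M (e \<circ> \<sigma>) \<phi>"
proof (induction \<phi> arbitrary: e \<sigma>)
  case (Rel r ts)
  have "map (eval_tm M e) (map (rename_tm \<sigma>) ts) = map (eval_tm M (e \<circ> \<sigma>)) ts"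
    by (simp add: eval_tm_rename)
  then show ?case by (simp only: sat.simps rename.simps)
next
  case (Exists \<phi>)
  have "case_nat a e \<circ> case_nat 0 (\<lambda>n. Suc (\<sigma> n)) = case_nat a (e \<circ> \<sigma>)" for a
    by (auto split: nat.split)
  then show ?case unfolding rename.simps sat.simps Exists by simp
qed (auto simp: eval_tm_rename)

lemma term_vars_rename: "term_vars (rename_tm \<sigma> t) = \<sigma> ` term_vars t"
  by (induction t) auto

lemma free_vars_rename: "free_vars (rename \<sigma> \<phi>) = \<sigma> ` free_vars \<phi>"
proof (induction \<phi> arbitrary: \<sigma>)
  case (Exists \<phi>)
  let ?s = "case_nat 0 (\<lambda>n. Suc (\<sigma> n))"
  have "Suc n \<in> ?s ` A \<longleftrightarrow> n \<in> \<sigma> ` {n. Suc n \<in> A}" for n A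
  proof
    assume "Suc n \<in> ?s ` A"
    then obtain k where k: "k \<in> A" "Suc n = ?s k" by blast
    then obtain j where "k = Suc j" by (cases k) auto
    then show "n \<in> \<sigma> ` {n. Suc n \<in> A}" using k by auto
  next
    assume "n \<in> \<sigma> ` {n. Suc n \<in> A}"
    then obtain k where k: "Suc k \<in> A" "n = \<sigma> k" by blast
    then have "Suc n = ?s (Suc k)" by simp
    then show "Suc n \<in> ?s ` A" using k(1) by blast
  qed
  then show ?case unfolding rename.simps free_vars.simps Exists.IH by blast
qed (auto simp: term_vars_rename)

lemma term_in_rename: "term_in L (rename_tm \<sigma> t) = term_in L t"
  by (induction t) (auto simp: list_all_iff)

lemma formula_in_rename: "formula_in L (rename \<sigma> \<phi>) = formula_in L \<phi>"
  by (induction \<phi> arbitrary: \<sigma>) (auto simp: term_in_rename)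

section \<open>Existential sentences and copies of finite subsets of \<open>M\<close> in
  \<open>N\<close>\<close>

text \<open>Index 0 belongs to the innermost quantifier, so its witness is the head of
  \<open>xs\<close>. The induction therefore splits off the innermost quantifier.\<close>

lemma sat_Exists_pow:
  "sat M e ((Exists ^^ n) \<phi>) \<longleftrightarrow>
    (\<exists>xs. length xs = n \<and> set xs \<subseteq> universe M \<and> sat M (\<lambda>k. if k < n then xs ! k else e (k - n)) \<phi>)"
proof (induction n arbitrary: \<phi> e)
  case (Suc n)
  have eq: "case_nat a (\<lambda>k. if k < n then xs ! k else e (k - n)) =
      (\<lambda>k. if k < Suc n then (a # xs) ! k else e (k - Suc n))" for a and xs :: "'a list"
    by (rule ext) (auto split: nat.split)
  have "sat M e ((Exists ^^ Suc n) \<phi>) \<longleftrightarrow> sat M e ((Exists ^^ n) (Exists \<phi>))"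
    by (simp only: funpow_Suc_right o_apply)
  also have "\<dots> \<longleftrightarrow> (\<exists>xs a. length xs = n \<and> set xs \<subseteq> universe M \<and> a \<in> universe M \<and>
      sat M (\<lambda>k. if k < Suc n then (a # xs) ! k else e (k - Suc n)) \<phi>)"
    unfolding Suc.IH sat.simps eq by auto
  also have "\<dots> \<longleftrightarrow> (\<exists>ys. length ys = Suc n \<and> set ys \<subseteq> universe M \<and>
      sat M (\<lambda>k. if k < Suc n then ys ! k else e (k - Suc n)) \<phi>)"
  proof (intro iffI; elim exE conjE)
    fix xs a assume "length xs = n" "set xs \<subseteq> universe M" "a \<in> universe M"
      "sat M (\<lambda>k. if k < Suc n then (a # xs) ! k else e (k - Suc n)) \<phi>"
    then show "\<exists>ys. length ys = Suc n \<and> set ys \<subseteq> universe M \<and>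
        sat M (\<lambda>k. if k < Suc n then ys ! k else e (k - Suc n)) \<phi>"
      by (intro exI[of _ "a # xs"]) simp
  next
    fix ys assume ys: "length ys = Suc n" "set ys \<subseteq> universe M"
      "sat M (\<lambda>k. if k < Suc n then ys ! k else e (k - Suc n)) \<phi>"
    then obtain a xs where a: "ys = a # xs" by (cases ys) auto
    then show "\<exists>xs a. length xs = n \<and> set xs \<subseteq> universe M \<and> a \<in> universe M \<and>
        sat M (\<lambda>k. if k < Suc n then (a # xs) ! k else e (k - Suc n)) \<phi>"
      using ys unfolding a by (intro exI[of _ xs] exI[of _ a]) simp
  qed
  finally show ?case .
qed auto

lemma sat_foldr_And: "sat M e (foldr And \<phi>s \<phi>) \<longleftrightarrow> (\<forall>\<psi>\<in>set (\<phi> # \<phi>s). sat M e \<psi>)"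
  by (induction \<phi>s) auto

lemma free_vars_foldr_And: "free_vars (foldr And \<phi>s \<phi>) = (\<Union>\<psi>\<in>set (\<phi> # \<phi>s). free_vars \<psi>)"
  by (induction \<phi>s) auto

lemma formula_in_foldr_And: "formula_in L (foldr And \<phi>s \<phi>) \<longleftrightarrow> (\<forall>\<psi>\<in>set (\<phi> # \<phi>s). formula_in L \<psi>)"
  by (induction \<phi>s) auto

lemma free_vars_Exists_pow: "free_vars ((Exists ^^ n) \<phi>) = {k. k + n \<in> free_vars \<phi>}"
  by (induction n) auto

lemma formula_in_Exists_pow: "formula_in L ((Exists ^^ n) \<phi>) = formula_in L \<phi>"
  by (induction n) auto

text \<open>All truth values of formulas of \<open>F\<close> at tuples from \<open>X\<close> are
  collected in one existential sentence over an enumeration of \<open>X\<close>. It is weakly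
  existential and true in \<open>M\<close>, and witnesses of its truth in \<open>N\<close> are the
  values of \<open>g\<close>.\<close>

lemma finite_partial_map_preserving:
  assumes M: "structure_of L M" and N: "structure_of L N"
    and \<Delta>: "\<forall>\<phi>\<in>\<Delta>. formula_in L \<phi>"
    and trans: "\<forall>\<phi>\<in>weakly_existential \<Delta>. sentence L \<phi> \<longrightarrow> true_in M \<phi> \<longrightarrow> true_in N \<phi>"
    and F: "finite F" "F \<subseteq> \<Delta>" and X: "finite X" "X \<subseteq> universe M"
  shows "\<exists>g. range g \<subseteq> universe N \<and>
    (\<forall>\<phi>\<in>F. \<forall>e. range e \<subseteq> X \<longrightarrow> (sat M e \<phi> \<longleftrightarrow> sat N (g \<circ> e) \<phi>))"
proof (cases "F = {} \<or> X = {}")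
  \<comment> \<open>Treated separately because a conjunction has at least one conjunct. For empty
    \<open>X\<close> no assignment has its range in \<open>X\<close>.\<close>
  case True
  obtain b where "b \<in> universe N" using N by (auto simp: structure_of_def)
  then show ?thesis using True by (intro exI[of _ "\<lambda>_. b"]) auto
next
  case False
  obtain xs where xs: "set xs = X" using X(1) finite_list by blast
  define p where "p = length xs"
  have p: "p > 0" using False xs by (auto simp: p_def)
  \<comment> \<open>The elements of \<open>\<Sigma> \<phi>\<close> place the free variables at
    positions of \<open>xs\<close>; the value 0 elsewhere makes them finite in number.\<close>
  define \<Sigma> where "\<Sigma> = (\<lambda>\<phi> :: ('a, 'b) fm. {\<sigma>. \<forall>n. (n \<in> free_vars \<phi> \<longrightarrow> \<sigma> n \<in> {..<p}) \<and>
    (n \<notin> free_vars \<phi> \<longrightarrow> \<sigma> n = 0)})"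
  have fin: "finite (\<Sigma> \<phi>)" for \<phi>
    unfolding \<Sigma>_def by (rule finite_set_of_finite_funs) (simp_all add: finite_free_vars)
  have \<Sigma>p: "\<sigma> n < p" if "\<sigma> \<in> \<Sigma> \<phi>" for \<sigma> \<phi> n
    using that p by (cases "n \<in> free_vars \<phi>") (auto simp: \<Sigma>_def)
  have \<Sigma>ne: "(\<lambda>_. 0) \<in> \<Sigma> \<phi>" for \<phi> using p by (auto simp: \<Sigma>_def)
  define lit where "lit = (\<lambda>\<phi> \<sigma>. if sat M (\<lambda>n. xs ! \<sigma> n) \<phi> then rename \<sigma> \<phi> else Neg (rename \<sigma> \<phi>))"
  define Lits where "Lits = (\<Union>\<phi>\<in>F. lit \<phi> ` \<Sigma> \<phi>)"
  have "finite Lits" unfolding Lits_def using F(1) fin by auto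
  moreover have "Lits \<noteq> {}" unfolding Lits_def using False \<Sigma>ne by auto
  ultimately obtain \<phi>0 \<phi>s where ls: "set (\<phi>0 # \<phi>s) = Lits"
    by (metis finite_list list.exhaust set_empty)
  define \<psi> where "\<psi> = (Exists ^^ p) (foldr And \<phi>s \<phi>0)"
  have "\<forall>\<theta>\<in>set (\<phi>0 # \<phi>s). \<theta> \<in> instances \<Delta> \<or> \<theta> \<in> Neg ` instances \<Delta>"
    unfolding ls Lits_def lit_def instances_def using F(2) by auto blast+
  then have "\<psi> \<in> weakly_existential \<Delta>"
    unfolding weakly_existential_def \<psi>_def by blast
  moreover have "sentence L \<psi>"
  proof -
    have "formula_in L \<theta> \<and> free_vars \<theta> \<subseteq> {..<p}" if "\<theta> \<in> Lits" for \<theta>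
      using that F(2) \<Delta> \<Sigma>p unfolding Lits_def lit_def
      by (auto simp: formula_in_rename free_vars_rename split: if_splits)
    then show ?thesis
      unfolding sentence_def \<psi>_def formula_in_Exists_pow free_vars_Exists_pow
        formula_in_foldr_And free_vars_foldr_And ls by fastforce
  qed
  moreover have "true_in M \<psi>"
  proof -
    have "sat M (\<lambda>k. if k < p then xs ! k else e (k - p)) \<theta>" if \<theta>: "\<theta> \<in> Lits" for e \<theta>
    proof -
      obtain \<phi> \<sigma> where 1: "\<phi> \<in> F" "\<sigma> \<in> \<Sigma> \<phi>" "\<theta> = lit \<phi> \<sigma>" using \<theta> by (auto simp: Lits_def)
      have "(\<lambda>k. if k < p then xs ! k else e (k - p)) \<circ> \<sigma> = (\<lambda>n. xs ! \<sigma> n)"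
        using \<Sigma>p[OF 1(2)] by auto
      then show ?thesis unfolding 1(3) lit_def by (auto simp: sat_rename)
    qed
    then show ?thesis
      unfolding true_in_def \<psi>_def sat_Exists_pow sat_foldr_And ls using xs X(2) p_def by blast
  qed
  ultimately have "true_in N \<psi>" using trans by blast
  moreover obtain b where b: "b \<in> universe N" using N by (auto simp: structure_of_def)
  ultimately have "sat N (\<lambda>_. b) \<psi>" unfolding true_in_def by auto
  then obtain ys where ys: "length ys = p" "set ys \<subseteq> universe N"
    and sat: "\<forall>\<theta>\<in>Lits. sat N (\<lambda>k. if k < p then ys ! k else b) \<theta>"
    unfolding \<psi>_def sat_Exists_pow sat_foldr_And ls by auto
  \<comment> \<open>The list \<open>xs\<close> may repeat entries and \<open>ys\<close> may differ
    at such positions, so one position is fixed for each point of \<open>X\<close>.\<close>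
  define idx where "idx = (\<lambda>x. SOME i. i < p \<and> xs ! i = x)"
  have idx: "idx x < p \<and> xs ! idx x = x" if "x \<in> X" for x
    unfolding idx_def by (rule someI_ex) (use that xs p_def in \<open>auto simp: in_set_conv_nth\<close>)
  define g where "g = (\<lambda>x. if x \<in> X then ys ! idx x else b)"
  have "range g \<subseteq> universe N"
    using ys idx b by (auto simp: g_def)
  moreover have "sat M e \<phi> \<longleftrightarrow> sat N (g \<circ> e) \<phi>" if \<phi>: "\<phi> \<in> F" and e: "range e \<subseteq> X" for \<phi> e
  proof -
    define \<sigma> where "\<sigma> = (\<lambda>n. if n \<in> free_vars \<phi> then idx (e n) else 0)"
    have eX: "e n \<in> X" for n using e by auto
    have \<sigma>: "\<sigma> \<in> \<Sigma> \<phi>" unfolding \<Sigma>_def \<sigma>_def using idx[OF eX] by auto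
    then have "lit \<phi> \<sigma> \<in> Lits" using \<phi> by (auto simp: Lits_def)
    with sat have s: "sat N (\<lambda>k. if k < p then ys ! k else b) (lit \<phi> \<sigma>)" by blast
    have "sat M e \<phi> \<longleftrightarrow> sat M (\<lambda>n. xs ! \<sigma> n) \<phi>"
      by (rule sat_cong) (use idx[OF eX] in \<open>auto simp: \<sigma>_def\<close>)
    moreover have "sat N (g \<circ> e) \<phi> \<longleftrightarrow> sat N ((\<lambda>k. if k < p then ys ! k else b) \<circ> \<sigma>) \<phi>"
      by (rule sat_cong) (use idx[OF eX] eX in \<open>auto simp: \<sigma>_def g_def\<close>)
    ultimately show ?thesis using s unfolding lit_def by (auto simp: sat_rename split: if_splits)
  qed
  ultimately show ?thesis by blast
qed

section \<open>Copying along a forest of bounded height\<close>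

text \<open>The strict bound counts proper predecessors; together with its top a branch has at most
  \<open>H\<close> points.\<close>

definition bounded_forest :: "'b set \<Rightarrow> nat \<Rightarrow> ('b \<times> 'b) set \<Rightarrow> bool" where
  "bounded_forest I H R \<longleftrightarrow> R \<subseteq> I \<times> I \<and> trans R \<and> irrefl R \<and>
     (\<forall>x y z. (x, z) \<in> R \<longrightarrow> (y, z) \<in> R \<longrightarrow> x = y \<or> (x, y) \<in> R \<or> (y, x) \<in> R) \<and>
     (\<forall>z. finite {x. (x, z) \<in> R} \<and> card {x. (x, z) \<in> R} < H)"

lemma bounded_forestD:
  assumes "bounded_forest I H R"
  shows "R \<subseteq> I \<times> I" "trans R" "irrefl R"
    "\<And>x y z. (x, z) \<in> R \<Longrightarrow> (y, z) \<in> R \<Longrightarrow> x = y \<or> (x, y) \<in> R \<or> (y, x) \<in> R"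
    "\<And>z. finite {x. (x, z) \<in> R}" "\<And>z. card {x. (x, z) \<in> R} < H"
  using assms unfolding bounded_forest_def by simp_all

lemma bounded_forest_height_less:
  assumes R: "bounded_forest I H R" and "(x, y) \<in> R"
  shows "card {w. (w, x) \<in> R} < card {w. (w, y) \<in> R}"
proof (rule psubset_card_mono)
  show "finite {w. (w, y) \<in> R}" by (rule bounded_forestD(5)[OF R])
  show "{w. (w, x) \<in> R} \<subset> {w. (w, y) \<in> R}"
    using assms(2) bounded_forestD(2,3)[OF R] by (auto simp: irrefl_def dest: transD)
qed

text \<open>A point of \<open>K\<close> with the largest number of predecessors is on top, because
  this number strictly increases along \<open>R\<close>.\<close>

lemma bounded_forest_chain_top:
  assumes R: "bounded_forest I H R" and K: "finite K" "K \<noteq> {}"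
    and chain: "\<And>x y. x \<in> K \<Longrightarrow> y \<in> K \<Longrightarrow> x = y \<or> (x, y) \<in> R \<or> (y, x) \<in> R"
  shows "\<exists>z\<in>K. K \<subseteq> insert z {x. (x, z) \<in> R}"
proof -
  let ?h = "\<lambda>y. card {w. (w, y) \<in> R}"
  have "Max (?h ` K) \<in> ?h ` K" using K by (intro Max_in) auto
  then obtain z where z: "z \<in> K" "Max (?h ` K) = ?h z" by blast
  have "x = z \<or> (x, z) \<in> R" if "x \<in> K" for x
  proof -
    have "?h x \<le> ?h z" using z(2) that K(1) Max_ge[of "?h ` K" "?h x"] by simp
    then have "(z, x) \<notin> R" using bounded_forest_height_less[OF R, of z x] by linarith
    then show ?thesis using chain[OF that z(1)] by blast
  qed
  then show ?thesis using z(1) by blast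
qed

primrec branch_upto :: "('b \<Rightarrow> 'b) \<Rightarrow> nat \<Rightarrow> 'b \<Rightarrow> 'b list" where
  "branch_upto p 0 z = [z]"
| "branch_upto p (Suc k) z = z # branch_upto p k (p z)"

text \<open>A branch is listed from its top downwards by passing repeatedly to the predecessor of
  greatest height. Every suffix is again the branch of a point, which makes choices along different
  branches compatible.\<close>

lemma forest_branches:
  assumes R: "bounded_forest I H R"
  shows "\<exists>br. \<forall>z\<in>I. set (br z) = insert z {x. (x, z) \<in> R} \<and> length (br z) \<le> H \<and>
    (\<exists>zs. br z = z # zs) \<and> (\<forall>i<length (br z). drop i (br z) = br (br z ! i))"
proof -
  note bounded_forestD[OF R]
  note tr = this(2) and irr = this(3) and lin = this(4) and fin = this(5) and H = this(6)
  define \<kappa> where "\<kappa> = (\<lambda>z. card {x. (x, z) \<in> R})"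
  define pr where "pr = (\<lambda>z. SOME y. (y, z) \<in> R \<and> {x. (x, z) \<in> R} = insert y {x. (x, y) \<in> R})"
  have \<kappa>_less: "\<kappa> x < \<kappa> y" if "(x, y) \<in> R" for x y
    using bounded_forest_height_less[OF R that] by (simp add: \<kappa>_def)
  have pr: "(pr z, z) \<in> R \<and> {x. (x, z) \<in> R} = insert (pr z) {x. (x, pr z) \<in> R}"
    if "\<kappa> z \<noteq> 0" for z
  proof -
    let ?A = "{x. (x, z) \<in> R}"
    have ne: "?A \<noteq> {}" using that unfolding \<kappa>_def by fastforce
    have "Max (\<kappa> ` ?A) \<in> \<kappa> ` ?A" using fin ne by (intro Max_in) auto
    then obtain y where "y \<in> ?A" "Max (\<kappa> ` ?A) = \<kappa> y" by blast
    then have y: "y \<in> ?A" "\<forall>x\<in>?A. \<kappa> x \<le> \<kappa> y"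
      using Max_ge[of "\<kappa> ` ?A"] fin by auto
    have "?A = insert y {x. (x, y) \<in> R}"
    proof (intro set_eqI iffI)
      fix x assume "x \<in> ?A"
      then show "x \<in> insert y {x. (x, y) \<in> R}"
        using lin[of x z y] y \<kappa>_less[of y x] by fastforce
    next
      fix x assume "x \<in> insert y {x. (x, y) \<in> R}"
      then show "x \<in> ?A" using y tr by (auto dest: transD)
    qed
    then show ?thesis unfolding pr_def using y(1)
      by (intro someI[of "\<lambda>y. (y, z) \<in> R \<and> {x. (x, z) \<in> R} = insert y {x. (x, y) \<in> R}" y]) auto
  qed
  have \<kappa>_pr: "\<kappa> (pr z) = k" if "\<kappa> z = Suc k" for z k
  proof -
    have "\<kappa> z = card (insert (pr z) {x. (x, pr z) \<in> R})" using pr[of z] that by (simp add: \<kappa>_def)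
    also have "\<dots> = Suc (\<kappa> (pr z))" using fin irr by (simp add: \<kappa>_def irrefl_def)
    finally show ?thesis using that by simp
  qed
  \<comment> \<open>Exactly \<open>\<kappa> z\<close> steps lead down to a root; \<open>pr\<close>
    is arbitrary at roots and is not applied there.\<close>
  define br where "br = (\<lambda>z. branch_upto pr (\<kappa> z) z)"
  have "set (br z) = insert z {x. (x, z) \<in> R} \<and> length (br z) = Suc (\<kappa> z) \<and>
    (\<exists>zs. br z = z # zs) \<and> (\<forall>i<length (br z). drop i (br z) = br (br z ! i))" for z
  proof (induction "\<kappa> z" arbitrary: z)
    case 0
    then show ?case using fin[of z] by (auto simp: br_def \<kappa>_def)
  next
    case (Suc k)
    have k: "\<kappa> (pr z) = k" using \<kappa>_pr Suc(2) by metis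
    note IH = Suc(1)[OF k[symmetric]]
    have br: "br z = z # br (pr z)" using k Suc(2)[symmetric] by (simp add: br_def)
    have "drop i (br z) = br (br z ! i)" if "i < length (br z)" for i
    proof (cases i)
      case 0
      then show ?thesis by (simp add: br)
    next
      case (Suc j)
      then show ?thesis using IH that by (simp add: br)
    qed
    moreover have "set (br z) = insert z {x. (x, z) \<in> R}"
      using IH pr[of z] Suc(2) by (simp add: br)
    moreover have "length (br z) = Suc (\<kappa> z)" using IH k Suc(2) by (simp add: br)
    ultimately show ?case using br by blast
  qed
  then show ?thesis using H unfolding \<kappa>_def by (metis Suc_leI)
qed

text \<open>
  The type of a tuple in the back-and-forth game with \<open>k\<close> rounds left, coded as a number. Tuples
  grow at the head. As long as \<open>c\<close> takes finitely many values on tuples of length \<open>H\<close>, all sets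
  that are encoded here are finite; on infinite sets \<open>set_encode\<close> would be \<open>0\<close>.
\<close>

primrec game_type :: "('a list \<Rightarrow> nat) \<Rightarrow> 'a set \<Rightarrow> nat \<Rightarrow> 'a list \<Rightarrow> nat" where
  "game_type c A 0 xs = c xs"
| "game_type c A (Suc k) xs = set_encode ((\<lambda>a. game_type c A k (a # xs)) ` A)"

text \<open>A type with \<open>Suc k\<close> rounds left encodes a set of types with
  \<open>k\<close> rounds left, so finiteness is inherited through power sets.\<close>

lemma finite_game_types:
  assumes "finite (c ` {xs. length xs = H \<and> set xs \<subseteq> A})"
  shows "k \<le> H \<Longrightarrow> finite (game_type c A k ` {xs. length xs = H - k \<and> set xs \<subseteq> A})"
proof (induction k)
  case (Suc k)
  let ?T = "game_type c A k ` {xs. length xs = H - k \<and> set xs \<subseteq> A}"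
  have "(\<lambda>a. game_type c A k (a # xs)) ` A \<in> Pow ?T" if "length xs = H - Suc k" "set xs \<subseteq> A" for xs
  proof -
    have "a # xs \<in> {xs. length xs = H - k \<and> set xs \<subseteq> A}" if "a \<in> A" for a
      using that \<open>length xs = _\<close> \<open>set xs \<subseteq> A\<close> Suc.prems by auto
    then show ?thesis by blast
  qed
  then have "game_type c A (Suc k) ` {xs. length xs = H - Suc k \<and> set xs \<subseteq> A} \<subseteq> set_encode ` Pow ?T"
    by fastforce
  moreover have "finite ?T" using Suc by simp
  ultimately show ?case by (meson finite_Pow_iff finite_imageI finite_subset)
qed (use assms in simp)

lemma finite_game_type_image:
  assumes "finite (c ` {xs. length xs = H \<and> set xs \<subseteq> A})"
    and "length xs + Suc k = H" "set xs \<subseteq> A"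
  shows "finite ((\<lambda>a. game_type c A k (a # xs)) ` A)"
proof (rule finite_subset)
  show "finite (game_type c A k ` {xs. length xs = H - k \<and> set xs \<subseteq> A})"
    using assms by (intro finite_game_types) auto
  show "(\<lambda>a. game_type c A k (a # xs)) ` A \<subseteq> game_type c A k ` {xs. length xs = H - k \<and> set xs \<subseteq> A}"
    using assms(2,3) by (intro image_subsetI imageI) auto
qed

text \<open>The forth step of the game: the encoded sets are finite, so equal codes offer the same
  types of moves.\<close>

lemma game_type_SucD:
  assumes fin: "finite (c ` {xs. length xs = H \<and> set xs \<subseteq> A})"
    and xs: "length xs + Suc k = H" "set xs \<subseteq> A" and ys: "length ys + Suc k = H" "set ys \<subseteq> A"
    and eq: "game_type c A (Suc k) xs = game_type c A (Suc k) ys" and a: "a \<in> A"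
  shows "\<exists>b\<in>A. game_type c A k (a # xs) = game_type c A k (b # ys)"
proof -
  have "(\<lambda>a. game_type c A k (a # xs)) ` A = (\<lambda>a. game_type c A k (a # ys)) ` A"
    using eq finite_game_type_image[OF fin xs] finite_game_type_image[OF fin ys]
    by (simp add: set_encode_eq)
  moreover have "game_type c A k (a # xs) \<in> (\<lambda>a. game_type c A k (a # xs)) ` A" using a by blast
  ultimately have "game_type c A k (a # xs) \<in> (\<lambda>a. game_type c A k (a # ys)) ` A" by simp
  then show ?thesis by blast
qed

text \<open>The remaining rounds are played with arbitrary moves on one side, available since
  \<open>A\<close> is nonempty. Moves are added at the head, so the first move ends up last in the
  padding.\<close>

lemma game_type_extend:
  assumes fin: "finite (c ` {xs. length xs = H \<and> set xs \<subseteq> A})" and "A \<noteq> {}"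
  shows "length xs + k = H \<Longrightarrow> set xs \<subseteq> A \<Longrightarrow> length ys + k = H \<Longrightarrow> set ys \<subseteq> A \<Longrightarrow>
    game_type c A k xs = game_type c A k ys \<Longrightarrow>
    \<exists>ps qs. length ps = k \<and> length qs = k \<and> set ps \<subseteq> A \<and> set qs \<subseteq> A \<and> c (ps @ xs) = c (qs @ ys)"
proof (induction k arbitrary: xs ys)
  case (Suc k)
  obtain a where a: "a \<in> A" using assms(2) by blast
  obtain b where b: "b \<in> A" "game_type c A k (a # xs) = game_type c A k (b # ys)"
    using game_type_SucD[OF fin Suc.prems a] by blast
  obtain ps qs where "length ps = k" "length qs = k" "set ps \<subseteq> A" "set qs \<subseteq> A"
      "c (ps @ a # xs) = c (qs @ b # ys)"
    using Suc.IH[of "a # xs" "b # ys"] Suc.prems a b by auto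
  then show ?case using a b
    by (intro exI[of _ "ps @ [a]"] exI[of _ "qs @ [b]"]) auto
qed auto

lemma finite_image_representatives:
  assumes "finite (f ` A)"
  shows "\<exists>W. finite W \<and> W \<subseteq> A \<and> (\<forall>d\<in>A. \<exists>b\<in>W. f b = f d)"
proof -
  obtain W where W: "W \<subseteq> A" "finite W" "f ` A = f ` W"
    using finite_subset_image[OF assms subset_refl] by auto
  have "\<exists>b\<in>W. f b = f d" if "d \<in> A" for d
  proof -
    have "f d \<in> f ` W" using that W(3) by blast
    then show ?thesis by (auto simp: eq_commute)
  qed
  then show ?thesis using W by blast
qed

text \<open>
  The points \<open>x z\<close> are chosen along the branches of the forest, so that the game types agree at every
  stage. Representatives of the finitely many types suffice as values. The paddings \<open>ps\<close> and \<open>qs\<close>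
  bring branches to the common length \<open>H\<close>.
\<close>

lemma finite_forest_copy:
  fixes c :: "'a list \<Rightarrow> nat" and a :: "'b \<Rightarrow> 'a"
  assumes fin: "finite (c ` {xs. length xs = H \<and> set xs \<subseteq> A})" and "A \<noteq> {}"
    and R: "bounded_forest I H R" and a: "a \<in> I \<rightarrow> A"
  shows "\<exists>X x. finite X \<and> X \<subseteq> A \<and> x \<in> I \<rightarrow> X \<and>
    (\<forall>z\<in>I. \<exists>zs ps qs. set zs = insert z {x. (x, z) \<in> R} \<and> length ps + length zs = H \<and>
      length qs = length ps \<and> set ps \<subseteq> A \<and> set qs \<subseteq> A \<and> c (ps @ map a zs) = c (qs @ map x zs))"
proof -
  obtain br where br: "\<And>z. z \<in> I \<Longrightarrow> set (br z) = insert z {x. (x, z) \<in> R}"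
      "\<And>z. z \<in> I \<Longrightarrow> length (br z) \<le> H" "\<And>z. z \<in> I \<Longrightarrow> \<exists>zs. br z = z # zs"
      "\<And>z i. z \<in> I \<Longrightarrow> i < length (br z) \<Longrightarrow> drop i (br z) = br (br z ! i)"
    using forest_branches[OF R] by metis
  have brI: "set (br z) \<subseteq> I" if "z \<in> I" for z
    using br(1)[OF that] that R unfolding bounded_forest_def by auto
  let ?g = "game_type c A"
  have "\<forall>xs\<in>{xs. length xs < H \<and> set xs \<subseteq> A}. \<exists>W. finite W \<and> W \<subseteq> A \<and>
      (\<forall>d\<in>A. \<exists>b\<in>W. ?g (H - Suc (length xs)) (b # xs) = ?g (H - Suc (length xs)) (d # xs))"
  proof
    fix xs assume "xs \<in> {xs. length xs < H \<and> set xs \<subseteq> A}"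
    then have "finite ((\<lambda>b. ?g (H - Suc (length xs)) (b # xs)) ` A)"
      by (intro finite_game_type_image[OF fin]) auto
    then show "\<exists>W. finite W \<and> W \<subseteq> A \<and>
        (\<forall>d\<in>A. \<exists>b\<in>W. ?g (H - Suc (length xs)) (b # xs) = ?g (H - Suc (length xs)) (d # xs))"
      by (rule finite_image_representatives)
  qed
  from bchoice[OF this] obtain W where W: "\<forall>xs\<in>{xs. length xs < H \<and> set xs \<subseteq> A}.
      finite (W xs) \<and> W xs \<subseteq> A \<and>
      (\<forall>d\<in>A. \<exists>b\<in>W xs. ?g (H - Suc (length xs)) (b # xs) = ?g (H - Suc (length xs)) (d # xs))"
    by (elim exE)
  have W: "finite (W xs)" "W xs \<subseteq> A"
      "d \<in> A \<Longrightarrow> \<exists>b\<in>W xs. ?g (H - Suc (length xs)) (b # xs) = ?g (H - Suc (length xs)) (d # xs)"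
    if "length xs < H" "set xs \<subseteq> A" for xs d
    using W that by simp_all
  \<comment> \<open>\<open>T k\<close> consists of the tuples of length \<open>k\<close> built from
    representatives only. The tree is finitely branching, so its levels up to \<open>H\<close> give
    a finite set \<open>X\<close>.\<close>
  define T where "T = rec_nat {[]} (\<lambda>_ T. \<Union>xs\<in>T. (\<lambda>b. b # xs) ` W xs)"
  have T0: "T 0 = {[]}" and TS: "T (Suc k) = (\<Union>xs\<in>T k. (\<lambda>b. b # xs) ` W xs)" for k
    by (simp_all add: T_def)
  have T: "finite (T k) \<and> (\<forall>xs\<in>T k. length xs = k \<and> set xs \<subseteq> A)" if "k \<le> H" for k
    using that
  proof (induction k)
    case (Suc k)
    then have IH: "finite (T k)" "\<And>xs. xs \<in> T k \<Longrightarrow> length xs = k \<and> set xs \<subseteq> A" by auto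
    then have "finite (W xs) \<and> W xs \<subseteq> A" if "xs \<in> T k" for xs
      using W[of xs] that Suc.prems by auto
    then show ?case unfolding TS using IH by auto
  qed (simp add: T0)
  define X where "X = (\<Union>k\<in>{..H}. \<Union>xs\<in>T k. set xs)"
  have X: "finite X" "X \<subseteq> A" unfolding X_def using T by auto
  \<comment> \<open>The choice at \<open>z\<close> depends on the branch below \<open>z\<close> and
    its copy, but on nothing above \<open>z\<close>. Hence \<open>G\<close> commutes with passing to
    suffixes.\<close>
  define pick where "pick = (\<lambda>z zs xs. SOME b. b \<in> W xs \<and>
    ?g (H - Suc (length zs)) (b # xs) = ?g (H - Suc (length zs)) (a z # map a zs))"
  define G where "G = rec_list [] (\<lambda>z zs xs. pick z zs xs # xs)"
  have G0: "G [] = []" and GS: "G (z # zs) = pick z zs (G zs) # G zs" for z zs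
    by (simp_all add: G_def)
  have drop_G: "drop i (G zs) = G (drop i zs)" for i zs
  proof (induction zs arbitrary: i)
    case (Cons z zs)
    then show ?case by (cases i) (simp_all add: GS)
  qed (simp add: G0)
  have G: "G zs \<in> T (length zs) \<and> ?g (H - length zs) (G zs) = ?g (H - length zs) (map a zs)"
    if "length zs \<le> H" "set zs \<subseteq> I" for zs
    using that
  proof (induction zs)
    case (Cons z zs)
    let ?k = "H - Suc (length zs)"
    have k: "H - length zs = Suc ?k" using Cons.prems by auto
    have IH: "G zs \<in> T (length zs)" "?g (Suc ?k) (map a zs) = ?g (Suc ?k) (G zs)"
      using Cons k by auto
    have l: "length (G zs) = length zs" "set (G zs) \<subseteq> A" using T[of "length zs"] IH(1) Cons.prems by auto
    have aA: "a z \<in> A" "set (map a zs) \<subseteq> A" using a Cons.prems by auto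
    \<comment> \<open>The original branch is extended by \<open>a z\<close>. Equality of types gives
      an answer \<open>d\<close> over the copy, and \<open>b\<close> is a representative of the same
      type.\<close>
    obtain d where d: "d \<in> A" "?g ?k (a z # map a zs) = ?g ?k (d # G zs)"
      using game_type_SucD[OF fin _ aA(2) _ l(2) IH(2) aA(1)] l(1) Cons.prems by auto
    obtain b where b: "b \<in> W (G zs)" "?g ?k (b # G zs) = ?g ?k (d # G zs)"
      using W(3)[OF _ l(2) d(1)] l(1) Cons.prems by auto
    have p: "pick z zs (G zs) \<in> W (G zs) \<and> ?g ?k (pick z zs (G zs) # G zs) = ?g ?k (a z # map a zs)"
      unfolding pick_def by (rule someI[of _ b]) (use b d in auto)
    then show ?case using IH(1) by (auto simp: GS TS)
  qed (simp add: G0 T0)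
  \<comment> \<open>Suffixes of branches are branches, so these heads reassemble to the whole copied
    branch.\<close>
  define x where "x = (\<lambda>z. hd (G (br z)))"
  have lenG: "length (G zs) = length zs" for zs by (induction zs) (simp_all add: G0 GS)
  have Gx: "G (br z) = map x (br z)" if z: "z \<in> I" for z
  proof (rule nth_equalityI)
    fix i assume "i < length (G (br z))"
    then have i: "i < length (br z)" by (simp add: lenG)
    have "G (br z) ! i = hd (drop i (G (br z)))" using i by (simp add: hd_drop_conv_nth lenG)
    also have "\<dots> = x (br z ! i)" unfolding drop_G br(4)[OF z i] x_def ..
    finally show "G (br z) ! i = map x (br z) ! i" using i by simp
  qed (simp add: lenG)
  have "x z \<in> X" if z: "z \<in> I" for z
  proof -
    have "G (br z) \<in> T (length (br z))" using G[OF br(2)[OF z] brI[OF z]] ..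
    moreover have "x z \<in> set (G (br z))" unfolding Gx[OF z] using br(1)[OF z] by auto
    ultimately show ?thesis unfolding X_def using br(2)[OF z] by blast
  qed
  moreover have "\<exists>zs ps qs. set zs = insert z {x. (x, z) \<in> R} \<and> length ps + length zs = H \<and>
      length qs = length ps \<and> set ps \<subseteq> A \<and> set qs \<subseteq> A \<and> c (ps @ map a zs) = c (qs @ map x zs)"
    if z: "z \<in> I" for z
  proof -
    note G = G[OF br(2)[OF z] brI[OF z]]
    have "set (map a (br z)) \<subseteq> A" using brI[OF z] a by auto
    moreover have "set (G (br z)) \<subseteq> A" using G T[OF br(2)[OF z]] by blast
    ultimately obtain ps qs where "length ps = H - length (br z)" "length qs = H - length (br z)"
        "set ps \<subseteq> A" "set qs \<subseteq> A" "c (ps @ map a (br z)) = c (qs @ G (br z))"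
      using game_type_extend[OF fin \<open>A \<noteq> {}\<close>, of "map a (br z)" "H - length (br z)" "G (br z)"]
        G br(2)[OF z] by (auto simp: lenG)
    then show ?thesis using br(1,2)[OF z] Gx[OF z]
      by (intro exI[of _ "br z"] exI[of _ ps] exI[of _ qs]) auto
  qed
  ultimately show ?thesis using X by (intro exI[of _ X] exI[of _ x] conjI ballI) auto
qed

section \<open>Coherent systems of forests\<close>

text \<open>
  \<open>(x, y) \<in> P n\<close> means that \<open>x\<close> lies below \<open>y\<close> in the \<open>n\<close>-th forest, and \<open>lab n x\<close> stands for the
  isomorphism type of the branch below \<open>x\<close> in the \<open>n\<close>-th forest, equipped with all earlier forests.
  All axioms are first-order; in particular the branches need not be finite or even well-founded.
\<close>

locale coherent_forests =
  fixes I U :: "'a set" and le :: "'a \<Rightarrow> 'a \<Rightarrow> bool" and P :: "'a \<Rightarrow> ('a \<times> 'a) set"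
    and lab :: "'a \<Rightarrow> 'a \<Rightarrow> 'a"
  assumes le_trans: "\<lbrakk>n \<in> U; m \<in> U; k \<in> U; le n m; le m k\<rbrakk> \<Longrightarrow> le n k"
    and le_total: "\<lbrakk>n \<in> U; m \<in> U\<rbrakk> \<Longrightarrow> le n m \<or> le m n"
    and P_sub: "n \<in> U \<Longrightarrow> P n \<subseteq> I \<times> I"
    and P_trans: "n \<in> U \<Longrightarrow> trans (P n)"
    and P_linear: "\<lbrakk>n \<in> U; (x, z) \<in> P n; (y, z) \<in> P n\<rbrakk> \<Longrightarrow> x = y \<or> (x, y) \<in> P n \<or> (y, x) \<in> P n"
    and P_mono: "\<lbrakk>n \<in> U; m \<in> U; le n m\<rbrakk> \<Longrightarrow> P n \<subseteq> P m"
    and P_cover: "\<lbrakk>x \<in> I; y \<in> I; x \<noteq> y\<rbrakk> \<Longrightarrow> \<exists>n\<in>U. (x, y) \<in> P n \<or> (y, x) \<in> P n"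
    and lab_in: "\<lbrakk>n \<in> U; x \<in> I\<rbrakk> \<Longrightarrow> lab n x \<in> U"
    and lab_neq: "\<lbrakk>n \<in> U; (x, y) \<in> P n\<rbrakk> \<Longrightarrow> lab n x \<noteq> lab n y"
    and lab_refine: "\<lbrakk>n \<in> U; m \<in> U; le n m; x \<in> I; y \<in> I; lab m x = lab m y\<rbrakk> \<Longrightarrow> lab n x = lab n y"
    and lab_lift: "\<lbrakk>n \<in> U; m \<in> U; le n m; y \<in> I; lab m x = lab m y; (x', x) \<in> P n\<rbrakk> \<Longrightarrow>
      \<exists>y'. (y', y) \<in> P n \<and> lab m y' = lab m x'"
begin

section \<open>Forests of finite height from finitely many stages\<close>

lemma finite_has_last:
  assumes "finite S" "S \<noteq> {}" "S \<subseteq> U"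
  shows "\<exists>N\<in>S. \<forall>n\<in>S. le n N"
  using assms
proof (induction S rule: finite_ne_induct)
  case (singleton n)
  then show ?case using le_total[of n n] by auto
next
  case (insert n S)
  then obtain N where N: "N \<in> S" "\<forall>n\<in>S. le n N" by auto
  have U: "n \<in> U" "N \<in> U" "S \<subseteq> U" using insert N by auto
  show ?case
  proof (cases "le n N")
    case False
    then have nN: "le N n" using le_total U by blast
    have "le m n" if "m \<in> S" for m
      using le_trans[of m N n] U N(2) that nN by blast
    then show ?thesis using le_total[of n n] U by auto
  qed (use N in auto)
qed

text \<open>
  The last conjunct says that for later stages \<open>m\<close> the label \<open>lab m x\<close> determines the labels
  of the predecessors of \<open>x\<close> in \<open>R\<close>; this is what bounds the number of labels in the next lemma.
\<close>

definition stage_forest :: "'a set \<Rightarrow> 'a set \<Rightarrow> nat \<Rightarrow> ('a \<times> 'a) set \<Rightarrow> bool" where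
  "stage_forest Q S H R \<longleftrightarrow> bounded_forest I H R \<and>
    (\<forall>n\<in>S. \<forall>x y. (x, y) \<in> P n \<longrightarrow> lab n x \<in> Q \<longrightarrow> lab n y \<in> Q \<longrightarrow> (x, y) \<in> R) \<and>
    (\<forall>m\<in>U. (\<forall>n\<in>S. le n m) \<longrightarrow> R \<subseteq> P m \<and>
      (\<forall>x y x'. y \<in> I \<longrightarrow> lab m x = lab m y \<longrightarrow> (x', x) \<in> R \<longrightarrow> (\<exists>y'. (y', y) \<in> R \<and> lab m y' = lab m x')))"

lemma stage_forestD:
  assumes "stage_forest Q S H R"
  shows "bounded_forest I H R"
    "\<And>n x y. n \<in> S \<Longrightarrow> (x, y) \<in> P n \<Longrightarrow> lab n x \<in> Q \<Longrightarrow> lab n y \<in> Q \<Longrightarrow> (x, y) \<in> R"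
    "\<And>m. m \<in> U \<Longrightarrow> \<forall>n\<in>S. le n m \<Longrightarrow> R \<subseteq> P m"
    "\<And>m x y x'. m \<in> U \<Longrightarrow> \<forall>n\<in>S. le n m \<Longrightarrow> y \<in> I \<Longrightarrow> lab m x = lab m y \<Longrightarrow> (x', x) \<in> R \<Longrightarrow>
      \<exists>y'. (y', y) \<in> R \<and> lab m y' = lab m x'"
  using assms unfolding stage_forest_def by simp_all

text \<open>The new forest consists of \<open>R\<close>, of \<open>P N\<close> on a suitable set
  \<open>V\<close>, and of compositions of the two. Points below a common point in
  \<open>P N\<close> have different \<open>N\<close>-labels, and only finitely many labels occur on
  \<open>V\<close>; this bounds the height.\<close>

lemma stage_forest_insert:
  assumes Q: "finite Q" and R: "stage_forest Q S H R" and S: "S \<subseteq> U"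
    and N: "N \<in> U" "\<forall>n\<in>S. le n N"
  shows "\<exists>H' R'. stage_forest Q (insert N S) H' R'"
proof -
  note bounded_forestD[OF stage_forestD(1)[OF R]]
  note sub = this(1) and trR = this(2) and lin = this(4) and finR = this(5) and H = this(6)
  note stage_forestD[OF R]
  note incl = this(2) and below = this(3) and lift = this(4)
  note RP = below[OF N]
  note trN = P_trans[OF N(1)]
  have irrN: "(x, x) \<notin> P N" for x using lab_neq[OF N(1)] by blast
  define Q' where "Q' = {q. \<exists>z\<in>I. lab N z \<in> Q \<and> (q = lab N z \<or> (\<exists>y. (y, z) \<in> R \<and> q = lab N y))}"
  \<comment> \<open>\<open>V\<close> contains all points with \<open>N\<close>-label in \<open>Q\<close>, is closed under \<open>R\<close>-predecessors, and still has
    only finitely many \<open>N\<close>-labels.\<close>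
  define V where "V = {z\<in>I. lab N z \<in> Q'}"
  have "finite Q'"
  proof -
    \<comment> \<open>By lifting, the \<open>N\<close>-labels of the \<open>R\<close>-predecessors
      of \<open>z\<close> depend only on the \<open>N\<close>-label of \<open>z\<close>. One point
      for each label in \<open>Q\<close> therefore accounts for all of \<open>Q'\<close>.\<close>
    define rp where "rp = (\<lambda>q. SOME z. z \<in> I \<and> lab N z = q)"
    have rp: "rp (lab N z) \<in> I \<and> lab N (rp (lab N z)) = lab N z" if "z \<in> I" for z
      unfolding rp_def by (rule someI[of _ z]) (use that in auto)
    have "Q' \<subseteq> Q \<union> (\<Union>q\<in>Q. lab N ` {y. (y, rp q) \<in> R})"
    proof
      fix q assume "q \<in> Q'"
      then obtain z where z: "z \<in> I" "lab N z \<in> Q" "q = lab N z \<or> (\<exists>y. (y, z) \<in> R \<and> q = lab N y)"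
        unfolding Q'_def by blast
      have "q \<in> lab N ` {y. (y, rp (lab N z)) \<in> R}" if yz: "(y, z) \<in> R" "q = lab N y" for y
      proof -
        obtain y' where y': "(y', rp (lab N z)) \<in> R \<and> lab N y' = lab N y"
          using lift[OF N conjunct1[OF rp[OF z(1)]] sym[OF conjunct2[OF rp[OF z(1)]]] yz(1)] by blast
        then show ?thesis using yz(2) by (intro image_eqI[of _ _ y']) simp_all
      qed
      then show "q \<in> Q \<union> (\<Union>q\<in>Q. lab N ` {y. (y, rp q) \<in> R})" using z by blast
    qed
    then show ?thesis using Q finR by (meson finite_UN_I finite_Un finite_imageI finite_subset)
  qed
  \<comment> \<open>The point \<open>z\<close> shares its label with some \<open>y\<close> that
    equals, or is \<open>R\<close>-below, a point \<open>w\<close> with label in \<open>Q\<close>.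
    Lifting \<open>x\<close> from \<open>z\<close> to \<open>y\<close> gives a point with the label
    of \<open>x\<close> that is \<open>R\<close>-below \<open>w\<close>.\<close>
  have V_down: "x \<in> V" if xz: "(x, z) \<in> R" "z \<in> V" for x z
  proof -
    have I: "x \<in> I" "z \<in> I" using xz sub by auto
    obtain w where w: "w \<in> I" "lab N w \<in> Q" "lab N z = lab N w \<or> (\<exists>y. (y, w) \<in> R \<and> lab N z = lab N y)"
      using xz(2) unfolding V_def Q'_def by blast
    then obtain y where y: "y = w \<or> (y, w) \<in> R" "lab N z = lab N y" "y \<in> I" using sub by blast
    obtain x' where x': "(x', y) \<in> R" "lab N x' = lab N x"
      using lift[OF N y(3,2) xz(1)] by blast
    then have "(x', w) \<in> R" using y(1) trR by (auto dest: transD)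
    then have "lab N x \<in> Q'" unfolding Q'_def using w(1,2) x'(2) by force
    then show ?thesis using I by (simp add: V_def)
  qed
  define A where "A = P N \<inter> V \<times> V"
  define R' where "R' = A \<union> R \<union> A O R"
  have trA: "trans A" using trN unfolding A_def trans_def by blast
  have RA: "R O A \<subseteq> A" using V_down RP trN unfolding A_def trans_def by blast
  have R'P: "R' \<subseteq> P N" using RP trN unfolding R'_def A_def trans_def by blast
  have "R' O R' \<subseteq> R'"
  proof -
    have "A O A \<subseteq> A" "R O R \<subseteq> R" using trA trR by (simp_all add: trans_O_subset)
    then show ?thesis using RA unfolding R'_def by (simp add: relcomp_distrib relcomp_distrib2) blast
  qed
  then have trR': "trans R'" unfolding trans_def by blast
  \<comment> \<open>The two points are comparable in \<open>P N\<close>; the comparability has to be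
    found in \<open>R'\<close>. A point outside \<open>V\<close> has no successor in
    \<open>A\<close>, so it can lie below \<open>z\<close> only through \<open>R\<close>.\<close>
  have lin': "(x, y) \<in> R'" if x: "(x, z) \<in> R'" and y: "(y, z) \<in> R'" and xy: "(x, y) \<in> P N" for x y z
  proof -
    have asym: "(v, w) \<in> P N \<Longrightarrow> (w, v) \<notin> P N" for v w using trN irrN by (meson transD)
    have nyx: "(y, x) \<notin> R" "x \<noteq> y" using asym[OF xy] RP irrN xy by blast+
    consider "x \<in> V" "y \<in> V" | "x \<notin> V" | "x \<in> V" "y \<notin> V" by blast
    then show ?thesis
    proof cases
      case 1
      then show ?thesis using xy by (simp add: R'_def A_def)
    next
      case 2
      then have xz: "(x, z) \<in> R" using x by (auto simp: R'_def A_def)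
      consider "(y, z) \<in> R" | "(y, z) \<in> A" | w where "(y, w) \<in> A" "(w, z) \<in> R"
        using y by (auto simp: R'_def)
      then show ?thesis
      proof cases
        case 1
        then show ?thesis using lin[OF xz 1] nyx by (auto simp: R'_def)
      next
        case c2: 2
        then show ?thesis using V_down[OF xz] 2 by (auto simp: A_def)
      next
        case 3
        have "w \<in> V" using 3 by (auto simp: A_def)
        then have "(w, x) \<in> R" using lin[OF xz 3(2)] V_down[of x w] 2 by blast
        then have "(y, x) \<in> P N" using 3 RP trN by (auto simp: A_def dest: transD)
        then show ?thesis using asym[OF xy] by blast
      qed
    next
      case 3
      then have yz: "(y, z) \<in> R" using y by (auto simp: R'_def A_def)
      consider "(x, z) \<in> R" | "(x, z) \<in> A" | w where "(x, w) \<in> A" "(w, z) \<in> R"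
        using x by (auto simp: R'_def)
      then show ?thesis
      proof cases
        case 1
        then show ?thesis using lin[OF yz 1] nyx by (auto simp: R'_def)
      next
        case 2
        then show ?thesis using V_down[OF yz] 3 by (auto simp: A_def)
      next
        case c3: 3
        have "w \<in> V" using c3 by (auto simp: A_def)
        then have "(w, y) \<in> R" using lin[OF yz c3(2)] V_down[of y w] 3 by blast
        then show ?thesis using c3 by (auto simp: R'_def)
      qed
    qed
  qed
  have A_fin: "finite {x. (x, z) \<in> A} \<and> card {x. (x, z) \<in> A} \<le> card Q'" for z
  proof -
    have "inj_on (lab N) {x. (x, z) \<in> A}"
    proof (rule inj_onI)
      fix x y assume "x \<in> {x. (x, z) \<in> A}" "y \<in> {x. (x, z) \<in> A}" "lab N x = lab N y"
      then show "x = y" using P_linear[OF N(1), of x z y] lab_neq[OF N(1)] by (auto simp: A_def) metis+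
    qed
    moreover have "lab N ` {x. (x, z) \<in> A} \<subseteq> Q'" by (auto simp: A_def V_def)
    ultimately show ?thesis using \<open>finite Q'\<close>
      by (meson card_inj_on_le inj_on_finite)
  qed
  \<comment> \<open>The summands bound the numbers of predecessors in \<open>A\<close>, in
    \<open>R\<close> and in \<open>A O R\<close>.\<close>
  define H' where "H' = Suc (card Q' + H + H * card Q')"
  have R'_fin: "finite {x. (x, z) \<in> R'} \<and> card {x. (x, z) \<in> R'} < H'" for z
  proof -
    let ?a = "\<lambda>z. {x. (x, z) \<in> A}" and ?r = "{x. (x, z) \<in> R}"
    have eq: "{x. (x, z) \<in> R'} = ?a z \<union> ?r \<union> (\<Union>w\<in>?r. ?a w)" by (auto simp: R'_def)
    have "card (\<Union>w\<in>?r. ?a w) \<le> (\<Sum>w\<in>?r. card (?a w))" using finR by (rule card_UN_le)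
    also have "\<dots> \<le> card ?r * card Q'" using sum_bounded_above[of ?r "\<lambda>w. card (?a w)" "card Q'"] A_fin by simp
    also have "\<dots> \<le> H * card Q'" using H[of z] by (intro mult_right_mono) auto
    finally have "card (\<Union>w\<in>?r. ?a w) \<le> H * card Q'" .
    moreover have "card (?a z \<union> ?r \<union> (\<Union>w\<in>?r. ?a w)) \<le> card (?a z) + card ?r + card (\<Union>w\<in>?r. ?a w)"
      by (rule order_trans[OF card_Un_le add_right_mono[OF card_Un_le]])
    moreover have "card (?a z) \<le> card Q'" using A_fin by blast
    ultimately have "card (?a z \<union> ?r \<union> (\<Union>w\<in>?r. ?a w)) < H'"
      using H[of z] unfolding H'_def by linarith
    then show ?thesis unfolding eq using A_fin finR by simp
  qed
  have "bounded_forest I H' R'"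
    unfolding bounded_forest_def
  proof (intro conjI allI impI)
    show "R' \<subseteq> I \<times> I" using sub unfolding R'_def A_def V_def by auto
    show "irrefl R'" using R'P irrN by (auto simp: irrefl_def)
    fix x y z assume "(x, z) \<in> R'" "(y, z) \<in> R'"
    then show "x = y \<or> (x, y) \<in> R' \<or> (y, x) \<in> R'"
      using P_linear[OF N(1), of x z y] R'P lin'[of x z y] lin'[of y z x] by blast
  qed (use trR' R'_fin in auto)
  moreover have "(x, y) \<in> R'" if "n \<in> insert N S" "(x, y) \<in> P n" "lab n x \<in> Q" "lab n y \<in> Q" for n x y
  proof (cases "n \<in> S")
    case True
    then show ?thesis using incl that by (auto simp: R'_def)
  next
    case False
    then have "n = N" using that by simp
    moreover have "x \<in> I" "y \<in> I" using that P_sub[OF N(1)] \<open>n = N\<close> by auto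
    ultimately have "x \<in> V" "y \<in> V" using that unfolding V_def Q'_def by auto
    then show ?thesis using that \<open>n = N\<close> by (auto simp: R'_def A_def)
  qed
  moreover have "R' \<subseteq> P m \<and> (\<forall>x y x'. y \<in> I \<longrightarrow> lab m x = lab m y \<longrightarrow> (x', x) \<in> R' \<longrightarrow>
      (\<exists>y'. (y', y) \<in> R' \<and> lab m y' = lab m x'))" if m: "m \<in> U" "\<forall>n\<in>insert N S. le n m" for m
  proof (intro conjI allI impI)
    have Nm: "le N m" and Sm: "\<forall>n\<in>S. le n m" using m by auto
    show "R' \<subseteq> P m" using R'P P_mono[OF N(1) m(1) Nm] by blast
    have lR: "\<exists>y'. (y', y) \<in> R \<and> lab m y' = lab m x'" if "y \<in> I" "lab m x = lab m y" "(x', x) \<in> R" for x y x'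
      using lift[OF m(1) Sm that] .
    have lA: "\<exists>y'. (y', y) \<in> A \<and> lab m y' = lab m x'" if y: "y \<in> I" "lab m x = lab m y" "(x', x) \<in> A" for x y x'
    proof -
      have x: "(x', x) \<in> P N" "x \<in> V" "x' \<in> V" using y by (auto simp: A_def)
      obtain y' where y': "(y', y) \<in> P N" "lab m y' = lab m x'"
        using lab_lift[OF N(1) m(1) Nm y(1,2) x(1)] by blast
      have I: "x \<in> I" "x' \<in> I" "y' \<in> I" using x y' P_sub[OF N(1)] by auto
      \<comment> \<open>Labels at the later stage \<open>m\<close> determine those at
        \<open>N\<close>, so membership in \<open>V\<close> carries over to \<open>y\<close> and
        \<open>y'\<close>.\<close>
      have "lab N x = lab N y" "lab N y' = lab N x'"
        using lab_refine[OF N(1) m(1) Nm I(1) y(1,2)] lab_refine[OF N(1) m(1) Nm I(3,2) y'(2)] by simp_all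
      then show ?thesis using x y y' I by (auto simp: A_def V_def)
    qed
    fix x y x' assume y: "y \<in> I" "lab m x = lab m y" and "(x', x) \<in> R'"
    then consider "(x', x) \<in> A" | "(x', x) \<in> R" | w where "(x', w) \<in> A" "(w, x) \<in> R"
      by (auto simp: R'_def)
    then show "\<exists>y'. (y', y) \<in> R' \<and> lab m y' = lab m x'"
    proof cases
      case 3
      obtain v where v: "(v, y) \<in> R" "lab m v = lab m w" using lR[OF y 3(2)] by blast
      then have "v \<in> I" using sub by auto
      then obtain y' where "(y', v) \<in> A" "lab m y' = lab m x'" using lA[OF _ _ 3(1)] v(2) by metis
      then show ?thesis using v by (auto simp: R'_def)
    next
      case 1
      then show ?thesis using lA[OF y] unfolding R'_def by blast
    next
      case 2
      then show ?thesis using lR[OF y] unfolding R'_def by blast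
    qed
  qed
  ultimately have "stage_forest Q (insert N S) H' R'" unfolding stage_forest_def by blast
  then show ?thesis by blast
qed

text \<open>A new stage has to come after all previous ones, so the induction splits off the last
  element of \<open>S\<close>.\<close>

lemma stage_forest_exists:
  assumes Q: "finite Q"
  shows "finite S \<Longrightarrow> S \<subseteq> U \<Longrightarrow> \<exists>H R. stage_forest Q S H R"
proof (induction "card S" arbitrary: S)
  case 0
  then have "S = {}" by simp
  moreover have "stage_forest Q {} 1 {}"
    by (auto simp: stage_forest_def bounded_forest_def irrefl_def)
  ultimately show ?case by blast
next
  case (Suc k)
  then have "S \<noteq> {}" by auto
  then obtain N where N: "N \<in> S" "\<forall>n\<in>S. le n N" using finite_has_last[of S] Suc by blast
  let ?S = "S - {N}"
  have "k = card ?S" using Suc N by simp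
  then obtain H R where "stage_forest Q ?S H R" using Suc(1)[of ?S] Suc(3,4) by auto
  then obtain H' R' where "stage_forest Q (insert N ?S) H' R'"
    using stage_forest_insert[OF Q, of ?S H R N] Suc(4) N by blast
  then show ?case using N by (metis insert_Diff)
qed

end

section \<open>A coherent system on the first uncountable cardinal\<close>

text \<open>If \<rho>(y, x) is the least \<open>n\<close> with \<open>y \<in> C x n\<close>, the
  last conjunct expresses the two subadditivity properties of \<rho>. The candidate \<open>c\<close>
  for \<open>C x\<close> is a separate argument, so that only values of \<open>C\<close> below
  \<open>x\<close> enter, as recursion requires.\<close>

definition coherent_at :: "('a \<times> 'a) set \<Rightarrow> ('a \<Rightarrow> nat \<Rightarrow> 'a set) \<Rightarrow> 'a \<Rightarrow> (nat \<Rightarrow> 'a set) \<Rightarrow> bool" where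
  "coherent_at ls C x c \<longleftrightarrow> (\<forall>n. finite (c n) \<and> c n \<subseteq> c (Suc n)) \<and> (\<Union>n. c n) = {y. (y, x) \<in> ls} \<and>
     (\<forall>n. \<forall>y\<in>c n. C y n = c n \<inter> {z. (z, y) \<in> ls})"

text \<open>
  Choose \<open>\<alpha> 0 \<le> \<alpha> 1 \<le> \<dots>\<close> cofinal below \<open>x\<close>. At level \<open>n\<close> put below \<open>x\<close> everything up to \<open>\<alpha> k\<close>,
  where \<open>k \<le> n\<close> is largest such that \<open>\<alpha> 0, \<dots>, \<alpha> k\<close> is a chain of the \<open>n\<close>-th forest.
\<close>

lemma coherent_at_extend:
  assumes ls: "trans ls" "wf ls" and tot: "\<And>y z. (y, x) \<in> ls \<Longrightarrow> (z, x) \<in> ls \<Longrightarrow> y = z \<or> (y, z) \<in> ls \<or> (z, y) \<in> ls"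
    and cnt: "countable {y. (y, x) \<in> ls}"
    and C: "\<And>y. (y, x) \<in> ls \<Longrightarrow> coherent_at ls C y (C y)"
  shows "\<exists>c. coherent_at ls C x c"
proof (cases "{y. (y, x) \<in> ls} = {}")
  case True
  then have "coherent_at ls C x (\<lambda>_. {})" by (simp add: coherent_at_def)
  then show ?thesis by (rule exI[of "coherent_at ls C x"])
next
  case False
  let ?B = "{y. (y, x) \<in> ls}"
  define \<gamma> where "\<gamma> = from_nat_into ?B"
  have \<gamma>: "range \<gamma> = ?B" unfolding \<gamma>_def using False cnt by (rule range_from_nat_into)
  have \<gamma>B: "(\<gamma> k, x) \<in> ls" for k using \<gamma> by blast
  \<comment> \<open>The running maximum of the enumeration \<open>\<gamma>\<close> of the points
    below \<open>x\<close>.\<close>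
  define \<alpha> where "\<alpha> = rec_nat (\<gamma> 0) (\<lambda>k a. if (a, \<gamma> (Suc k)) \<in> ls then \<gamma> (Suc k) else a)"
  have \<alpha>0: "\<alpha> 0 = \<gamma> 0" and \<alpha>S: "\<alpha> (Suc k) = (if (\<alpha> k, \<gamma> (Suc k)) \<in> ls then \<gamma> (Suc k) else \<alpha> k)" for k
    by (simp_all add: \<alpha>_def)
  have \<alpha>B: "(\<alpha> k, x) \<in> ls" for k by (induction k) (simp_all add: \<alpha>0 \<alpha>S \<gamma>B)
  have \<gamma>\<alpha>: "\<gamma> k = \<alpha> k \<or> (\<gamma> k, \<alpha> k) \<in> ls" for k
  proof (cases k)
    case (Suc j)
    then show ?thesis using tot[OF \<gamma>B[of "Suc j"] \<alpha>B[of j]] by (auto simp: \<alpha>S)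
  qed (simp add: \<alpha>0)
  have C1: "finite (C y n)" "C y n \<subseteq> C y (Suc n)" "(\<Union>n. C y n) = {z. (z, y) \<in> ls}"
      "\<And>z. z \<in> C y n \<Longrightarrow> C z n = C y n \<inter> {w. (w, z) \<in> ls}" if "(y, x) \<in> ls" for y n
    using C[OF that] by (simp_all add: coherent_at_def)
  have Cls: "(z, y) \<in> ls" if "z \<in> C y n" "(y, x) \<in> ls" for z y n
    using C1(3)[OF that(2)] that(1) by blast
  have Cmono: "C y n \<subseteq> C y m" if "n \<le> m" "(y, x) \<in> ls" for y n m
    using lift_Suc_mono_le[of "C y", OF C1(2)[OF that(2)] that(1)] .
  have irr: "(y, y) \<notin> ls" for y using ls(2) by (simp add: wf_irrefl)
  have asym: "(y, z) \<notin> ls" if "(z, y) \<in> ls" for y z using ls(2) that by (meson wf_asym)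
  define le where "le = (\<lambda>n y z. y = z \<or> y \<in> C z n)"
  have le_trans: "le n y w" if "le n y z" "le n z w" "(w, x) \<in> ls" for n y z w
    using that C1(4)[OF that(3), of z n] by (auto simp: le_def)
  have le_mono: "le m y z" if "le n y z" "n \<le> m" "(z, x) \<in> ls" for n m y z
    using that Cmono[OF that(2,3)] by (auto simp: le_def)
  have le_lin: "z \<in> C y n" if "le n z w" "le n y w" "(z, y) \<in> ls" "(w, x) \<in> ls" for z y w n
  proof -
    have wB: "(w, x) \<in> ls" by (fact that(4))
    show ?thesis
    proof (cases "y = w")
      case True
      then show ?thesis using that irr by (auto simp: le_def)
    next
      case False
      then have yw: "y \<in> C w n" using that by (simp add: le_def)
      moreover have "z \<in> C w n" using that False Cls[OF yw wB] asym by (auto simp: le_def)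
      ultimately show ?thesis using C1(4)[OF wB yw] that(3) by auto
    qed
  qed
  have ev: "\<forall>\<^sub>F n in sequentially. le n y z" if "y = z \<or> (y, z) \<in> ls" "(z, x) \<in> ls" for y z
  proof -
    have "\<exists>n. le n y z" using that(1) C1(3)[OF that(2)] by (auto simp: le_def)
    then show ?thesis unfolding eventually_sequentially using le_mono that(2) by blast
  qed
  define chain where "chain = (\<lambda>n k. \<forall>j<k. le n (\<alpha> j) (\<alpha> (Suc j)))"
  \<comment> \<open>By \<open>chain_le\<close>, admitting every such \<open>k\<close> gives the same
    set as taking the largest one. The bound \<open>k \<le> n\<close> keeps \<open>c n\<close>
    finite.\<close>
  define c where "c = (\<lambda>n. {y. \<exists>k\<le>n. chain n k \<and> le n y (\<alpha> k)})"
  have chain_le: "le n (\<alpha> j) (\<alpha> k)" if "j \<le> k" "chain n k" for j k n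
    using that
  proof (induction k)
    case (Suc k)
    show ?case
    proof (cases "j = Suc k")
      case False
      then have "le n (\<alpha> j) (\<alpha> k)" using Suc by (auto simp: chain_def)
      moreover have "le n (\<alpha> k) (\<alpha> (Suc k))" using Suc.prems by (simp add: chain_def)
      ultimately show ?thesis using le_trans \<alpha>B by blast
    qed (simp add: le_def)
  qed (simp add: le_def)
  have "coherent_at ls C x c"
    unfolding coherent_at_def
  proof (intro conjI allI ballI)
    fix n
    have "c n \<subseteq> (\<Union>k\<in>{..n}. insert (\<alpha> k) (C (\<alpha> k) n))" by (auto simp: c_def le_def)
    then show "finite (c n)" by (rule finite_subset) (simp add: C1(1)[OF \<alpha>B])
    show "c n \<subseteq> c (Suc n)"
    proof
      fix y assume "y \<in> c n"
      then obtain k where k: "k \<le> n" "chain n k" "le n y (\<alpha> k)" by (auto simp: c_def)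
      then have "chain (Suc n) k" "le (Suc n) y (\<alpha> k)"
        using le_mono[of n _ _ "Suc n"] \<alpha>B by (auto simp: chain_def)
      then show "y \<in> c (Suc n)" using k(1) unfolding c_def by (intro CollectI exI[of _ k]) simp
    qed
  next
    have cB: "y \<in> ?B" if yc: "y \<in> c n" for y n
    proof -
      obtain k where "le n y (\<alpha> k)" using yc by (auto simp: c_def)
      then show ?thesis using \<alpha>B[of k] Cls[of y "\<alpha> k" n] ls(1) by (auto simp: le_def dest: transD)
    qed
    \<comment> \<open>Each comparability below \<open>x\<close> holds at all late levels. Hence
      those forming the chain up to \<open>\<alpha> k\<close> and the one between \<open>y\<close>
      and \<open>\<alpha> k\<close> hold together at some level \<open>n \<ge> k\<close>.\<close>
    have Bc: "\<exists>n. y \<in> c n" if y: "y \<in> ?B" for y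
    proof -
      obtain k where k: "y = \<gamma> k" using y \<gamma> by blast
      have "\<forall>\<^sub>F n in sequentially. le n y (\<alpha> k)" using ev \<gamma>\<alpha> \<alpha>B k by auto
      moreover have "\<forall>\<^sub>F n in sequentially. \<forall>j\<in>{..<k}. le n (\<alpha> j) (\<alpha> (Suc j))"
        by (intro eventually_ball_finite ballI ev) (auto simp: \<alpha>S \<gamma>B \<alpha>B)
      ultimately have "\<forall>\<^sub>F n in sequentially. k \<le> n \<and> chain n k \<and> le n y (\<alpha> k)"
        using eventually_ge_at_top[of k] by eventually_elim (auto simp: chain_def)
      then obtain n where "k \<le> n" "chain n k" "le n y (\<alpha> k)"
        unfolding eventually_sequentially by blast
      then show ?thesis unfolding c_def by blast
    qed
    show "(\<Union>n. c n) = ?B"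
    proof (intro set_eqI iffI)
      fix y assume "y \<in> (\<Union>n. c n)"
      then show "y \<in> ?B" by (elim UN_E) (rule cB)
    next
      fix y assume "y \<in> ?B"
      from Bc[OF this] show "y \<in> (\<Union>n. c n)" by simp
    qed
  next
    fix n y assume "y \<in> c n"
    then obtain k where k: "k \<le> n" "chain n k" "le n y (\<alpha> k)" by (auto simp: c_def)
    then have yB: "(y, x) \<in> ls" using \<alpha>B[of k] Cls[of y "\<alpha> k" n] ls(1) by (auto simp: le_def dest: transD)
    show "C y n = c n \<inter> {z. (z, y) \<in> ls}"
    proof (intro set_eqI iffI)
      fix z assume z: "z \<in> C y n"
      then have "le n z (\<alpha> k)" using le_trans[of n z y "\<alpha> k"] k(3) \<alpha>B by (simp add: le_def)
      then show "z \<in> c n \<inter> {z. (z, y) \<in> ls}" using k(1,2) Cls[OF z yB] unfolding c_def by blast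
    next
      fix z assume z: "z \<in> c n \<inter> {z. (z, y) \<in> ls}"
      then obtain k' where k': "k' \<le> n" "chain n k'" "le n z (\<alpha> k')" by (auto simp: c_def)
      \<comment> \<open>Both points lie under \<open>\<alpha> K\<close> at level \<open>n\<close>,
        where \<open>le_lin\<close> compares them.\<close>
      define K where "K = max k k'"
      have "chain n K" using k(2) k'(2) by (auto simp: K_def max_def)
      then have "le n (\<alpha> k) (\<alpha> K)" "le n (\<alpha> k') (\<alpha> K)" by (auto intro!: chain_le simp: K_def)
      then have "le n y (\<alpha> K)" "le n z (\<alpha> K)" using le_trans k(3) k'(3) \<alpha>B by blast+
      then show "z \<in> C y n" using le_lin[of n z "\<alpha> K" y] z \<alpha>B by simp
    qed
  qed
  then show ?thesis by (rule exI[of "coherent_at ls C x"])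
qed

lemma coherent_sequence_exists:
  assumes ls: "trans ls" "wf ls" and tot: "total_on I ls" and sub: "ls \<subseteq> I \<times> I"
    and cnt: "\<And>x. countable {y. (y, x) \<in> ls}"
  shows "\<exists>C. \<forall>x. coherent_at ls C x (C x)"
proof (rule dependent_wf_choice[OF ls(2)])
  fix f g :: "'a \<Rightarrow> nat \<Rightarrow> 'a set" and x c
  assume fg: "\<And>z. (z, x) \<in> ls \<Longrightarrow> f z = g z"
  have "(\<forall>n. \<forall>y\<in>c n. f y n = c n \<inter> {z. (z, y) \<in> ls}) \<longleftrightarrow> (\<forall>n. \<forall>y\<in>c n. g y n = c n \<inter> {z. (z, y) \<in> ls})"
    if "(\<Union>n. c n) = {y. (y, x) \<in> ls}"
  proof -
    have "f y = g y" if "y \<in> c n" for y n using fg \<open>(\<Union>n. c n) = _\<close> that by blast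
    then show ?thesis by auto
  qed
  then show "coherent_at ls f x c = coherent_at ls g x c" unfolding coherent_at_def
    by (intro conj_cong refl)
next
  fix x and f :: "'a \<Rightarrow> nat \<Rightarrow> 'a set"
  assume "\<And>y. (y, x) \<in> ls \<Longrightarrow> coherent_at ls f y (f y)"
  moreover have "y = z \<or> (y, z) \<in> ls \<or> (z, y) \<in> ls" if "(y, x) \<in> ls" "(z, x) \<in> ls" for y z
    using tot sub that by (auto simp: total_on_def)
  ultimately show "\<exists>c. coherent_at ls f x c" using coherent_at_extend[OF ls _ cnt] by blast
qed

section \<open>Labels for the isomorphism types of branches\<close>

text \<open>Recursion along \<open>ls\<close> with \<open>m\<close> fixed, as in the coding of
  hereditarily finite sets. For each \<open>y\<close> on the branch the code records the code of
  \<open>y\<close> and the stages up to \<open>m\<close> at which \<open>y\<close> lies below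
  \<open>x\<close>; these traces make a label determine the labels of earlier stages.\<close>

lemma hereditary_code_exists:
  assumes "wf ls" and C: "\<And>x m. C x m \<subseteq> {y. (y, x) \<in> ls}"
  shows "\<exists>code. \<forall>x m. code x m =
    set_encode ((\<lambda>y. prod_encode (code y m, set_encode {p. p \<le> m \<and> y \<in> C x p})) ` C x m)"
proof -
  have "\<exists>code. \<forall>x. code x = (\<lambda>m.
    set_encode ((\<lambda>y. prod_encode (code y m, set_encode {p. p \<le> m \<and> y \<in> C x p})) ` C x m))"
  proof (rule dependent_wf_choice[OF assms(1)])
    fix f g :: "'a \<Rightarrow> nat \<Rightarrow> nat" and x c
    assume fg: "\<And>z. (z, x) \<in> ls \<Longrightarrow> f z = g z"
    have "(\<lambda>y. prod_encode (f y m, set_encode {p. p \<le> m \<and> y \<in> C x p})) ` C x m =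
        (\<lambda>y. prod_encode (g y m, set_encode {p. p \<le> m \<and> y \<in> C x p})) ` C x m" for m
      by (intro image_cong refl) (use fg[OF subsetD[OF C, simplified]] in simp)
    then show "(c = (\<lambda>m. set_encode ((\<lambda>y. prod_encode (f y m, set_encode {p. p \<le> m \<and> y \<in> C x p})) ` C x m)))
        = (c = (\<lambda>m. set_encode ((\<lambda>y. prod_encode (g y m, set_encode {p. p \<le> m \<and> y \<in> C x p})) ` C x m)))"
      by simp
  qed (rule exI, rule refl)
  then show ?thesis by (simp add: fun_eq_iff)
qed

text \<open>The codes serve as labels. Stages and labels are numbers, moved into \<open>I\<close> by
  an injection \<open>u\<close>, because the system is to become a one-sorted structure with a
  predicate for \<open>U\<close>.\<close>

lemma coherent_forests_exist:
  assumes ls: "trans ls" "wf ls" and tot: "total_on I ls" and sub: "ls \<subseteq> I \<times> I"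
    and cnt: "\<And>x. countable {y. (y, x) \<in> ls}" and "infinite I"
  shows "\<exists>U le P lab. coherent_forests I U le P lab \<and> U \<subseteq> I \<and> |U| =o natLeq"
proof -
  obtain C where C: "\<And>x. coherent_at ls C x (C x)"
    using coherent_sequence_exists[OF ls tot sub cnt] by blast
  have Cfin: "finite (C x n)" and CS: "C x n \<subseteq> C x (Suc n)" and CU: "(\<Union>n. C x n) = {y. (y, x) \<in> ls}"
    and Ccoh: "y \<in> C x n \<Longrightarrow> C y n = C x n \<inter> {z. (z, y) \<in> ls}" for x y n
    using C[of x] by (simp_all add: coherent_at_def)
  have Cls: "C x n \<subseteq> {y. (y, x) \<in> ls}" for x n using CU[of x] by blast
  have Cmono: "C x n \<subseteq> C x m" if "n \<le> m" for x n m
    using lift_Suc_mono_le[of "C x", OF CS that] .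
  have Ctrans: "z \<in> C x n" if "z \<in> C y n" "y \<in> C x n" for x y z n
    using Ccoh[OF that(2)] that(1) by blast
  obtain code where code: "\<And>x m. code x m =
      set_encode ((\<lambda>y. prod_encode (code y m, set_encode {p. p \<le> m \<and> y \<in> C x p})) ` C x m)"
    using hereditary_code_exists[OF ls(2), of C] Cls by blast
  \<comment> \<open>Branches are finite, so equal codes encode equal sets of pairs, and the pair of
    \<open>x'\<close> reappears in the branch of \<open>y\<close>.\<close>
  have code_lift: "\<exists>y'\<in>C y m. code y' m = code x' m \<and> (\<forall>p\<le>m. y' \<in> C y p \<longleftrightarrow> x' \<in> C x p)"
    if eq: "code x m = code y m" and x': "x' \<in> C x m" for x y x' m
  proof -
    let ?F = "\<lambda>x y. prod_encode (code y m, set_encode {p. p \<le> m \<and> y \<in> C x p})"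
    have "?F x ` C x m = ?F y ` C y m"
      using eq Cfin unfolding code[of x m] code[of y m] by (simp add: set_encode_eq)
    then have "?F x x' \<in> ?F y ` C y m" using x' by blast
    then obtain y' where y': "y' \<in> C y m" "?F x x' = ?F y y'" by blast
    then have "code y' m = code x' m" "{p. p \<le> m \<and> x' \<in> C x p} = {p. p \<le> m \<and> y' \<in> C y p}"
      by (simp_all add: set_encode_eq)
    then show ?thesis using y'(1) by blast
  qed
  have code_neq: "code x' m \<noteq> code x m" if "x' \<in> C x m" for x x' m
    using that
  proof (induction x arbitrary: x' rule: wf_induct_rule[OF ls(2)])
    case (1 x)
    show ?case
    proof
      assume "code x' m = code x m"
      \<comment> \<open>Lifting \<open>x'\<close> from the branch of \<open>x\<close> to that of
        \<open>x'\<close> produces a counterexample further down.\<close>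
      then obtain x'' where "x'' \<in> C x' m" "code x'' m = code x' m"
        using code_lift[of x m x' x'] 1(2) by auto
      then show False using 1(1)[of x' x''] 1(2) Cls by blast
    qed
  qed
  have code_refine: "code x n = code y n" if "n \<le> m" "code x m = code y m" for x y n m
    using that(2)
  proof (induction x arbitrary: y rule: wf_induct_rule[OF ls(2)])
    case (1 x)
    let ?F = "\<lambda>x y. prod_encode (code y n, set_encode {p. p \<le> n \<and> y \<in> C x p})"
    \<comment> \<open>Traces up to stage \<open>m\<close> determine those up to \<open>n\<close>,
      and the \<open>n\<close>-codes of predecessors agree by the induction hypothesis.\<close>
    have *: "?F x x' = ?F y y'" if "x' \<in> C x n" "code y' m = code x' m"
        "\<forall>p\<le>m. y' \<in> C y p \<longleftrightarrow> x' \<in> C x p" for x' y'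
    proof -
      have "{p. p \<le> n \<and> x' \<in> C x p} = {p. p \<le> n \<and> y' \<in> C y p}" using that(3) \<open>n \<le> m\<close> by auto
      moreover have "code x' n = code y' n" using 1(1)[of x' y'] that(1,2) Cls by auto
      ultimately show ?thesis by simp
    qed
    have "?F x ` C x n = ?F y ` C y n"
    proof (intro set_eqI iffI)
      fix k assume "k \<in> ?F x ` C x n"
      then obtain x' where x': "x' \<in> C x n" "k = ?F x x'" by blast
      then obtain y' where "code y' m = code x' m" "\<forall>p\<le>m. y' \<in> C y p \<longleftrightarrow> x' \<in> C x p"
        using code_lift[OF 1(2), of x'] Cmono[OF \<open>n \<le> m\<close>] by blast
      then show "k \<in> ?F y ` C y n" using *[OF x'(1)] x' \<open>n \<le> m\<close> by (intro image_eqI[of _ _ y']) auto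
    next
      fix k assume "k \<in> ?F y ` C y n"
      then obtain y' where y': "y' \<in> C y n" "k = ?F y y'" by blast
      then obtain x' where "code x' m = code y' m" "\<forall>p\<le>m. x' \<in> C x p \<longleftrightarrow> y' \<in> C y p"
        using code_lift[OF 1(2)[symmetric], of y'] Cmono[OF \<open>n \<le> m\<close>] by blast
      then show "k \<in> ?F x ` C x n" using *[of x' y'] y' \<open>n \<le> m\<close> by (intro image_eqI[of _ _ x']) auto
    qed
    then show ?case unfolding code[of x n] code[of y n] by (rule arg_cong)
  qed
  obtain u :: "nat \<Rightarrow> 'a" where u: "inj u" "range u \<subseteq> I"
    using infinite_countable_subset[OF \<open>infinite I\<close>] by blast
  define idx where "idx = inv u"
  have idx: "idx (u k) = k" for k using u(1) by (simp add: idx_def)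
  define P where "P = (\<lambda>a. {(y, x). y \<in> C x (idx a)})"
  define lab where "lab = (\<lambda>a x. u (code x (idx a)))"
  have lab_eq: "lab a x = lab b y \<longleftrightarrow> code x (idx a) = code y (idx b)" for a b x y
    using u(1) by (simp add: lab_def inj_eq)
  have "coherent_forests I (range u) (\<lambda>a b. idx a \<le> idx b) P lab"
  proof
    fix n x y assume "x \<in> I" "y \<in> I" "x \<noteq> y"
    then have "(x, y) \<in> ls \<or> (y, x) \<in> ls" using tot by (auto simp: total_on_def)
    then obtain k where "x \<in> C y k \<or> y \<in> C x k" using CU[of x] CU[of y] by blast
    then show "\<exists>n\<in>range u. (x, y) \<in> P n \<or> (y, x) \<in> P n" by (auto simp: P_def idx)
  next
    fix n show "P n \<subseteq> I \<times> I" using Cls sub by (auto simp: P_def)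
  next
    fix n show "trans (P n)" using Ctrans by (auto simp: P_def trans_def)
  next
    fix n x y z assume "(x, z) \<in> P n" "(y, z) \<in> P n"
    then have xy: "x \<in> C z (idx n)" "y \<in> C z (idx n)" by (simp_all add: P_def)
    then have "x \<in> I" "y \<in> I" using Cls sub by blast+
    then have "x = y \<or> (x, y) \<in> ls \<or> (y, x) \<in> ls" using tot by (auto simp: total_on_def)
    then show "x = y \<or> (x, y) \<in> P n \<or> (y, x) \<in> P n"
      using xy Ccoh[OF xy(1)] Ccoh[OF xy(2)] by (auto simp: P_def)
  next
    fix n m assume "idx n \<le> idx m"
    then show "P n \<subseteq> P m" using Cmono by (auto simp: P_def)
  next
    fix n x y assume "(x, y) \<in> P n"
    then show "lab n x \<noteq> lab n y" using code_neq by (simp add: P_def lab_eq)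
  next
    fix n m x y assume "idx n \<le> idx m" "lab m x = lab m y"
    then show "lab n x = lab n y" using code_refine[of "idx n" "idx m" x y] by (simp add: lab_eq)
  next
    fix n m y x x' assume le: "idx n \<le> idx m" and "lab m x = lab m y" "(x', x) \<in> P n"
    then have "code x (idx m) = code y (idx m)" "x' \<in> C x (idx n)" by (simp_all add: P_def lab_eq)
    then obtain y' where "y' \<in> C y (idx n)" "code y' (idx m) = code x' (idx m)"
      using code_lift[of x "idx m" y x'] Cmono[OF le] le by blast
    then show "\<exists>y'. (y', y) \<in> P n \<and> lab m y' = lab m x'" by (auto simp: P_def lab_eq)
  qed (auto simp: lab_def)
  moreover have "|range u| =o natLeq"
  proof -
    have "|UNIV :: nat set| =o |range u|" using u(1) card_of_ordIsoI[of u UNIV "range u"] by (simp add: bij_betw_def)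
    then show ?thesis using card_of_nat ordIso_symmetric ordIso_transitive by blast
  qed
  ultimately show ?thesis using u(2) by blast
qed

text \<open>The strict part of \<open>cardSuc natLeq\<close> is a well-order whose proper initial
  segments are countable.\<close>

lemma coherent_forests_aleph1:
  "\<exists>(I :: nat set set) U le P lab. coherent_forests I U le P lab \<and> U \<subseteq> I \<and>
    |I| =o cardSuc natLeq \<and> |U| =o natLeq"
proof -
  let ?r = "cardSuc natLeq"
  let ?I = "Field ?r"
  have card: "Card_order ?r" by (rule cardSuc_Card_order[OF natLeq_Card_order])
  have wo: "Well_order ?r" by (rule cardSuc_Well_order[OF natLeq_Card_order])
  then have "trans ?r" "antisym ?r" "total_on ?I ?r" "wf (?r - Id)"
    by (simp_all add: well_order_on_def linear_order_on_def partial_order_on_def preorder_on_def)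
  then have 1: "trans (?r - Id)" "total_on ?I (?r - Id)" "wf (?r - Id)"
    by (simp_all add: trans_diff_Id)
  have sub: "?r - Id \<subseteq> ?I \<times> ?I" by (auto simp: Field_def)
  have cnt: "countable {y. (y, x) \<in> ?r - Id}" for x
  proof (cases "x \<in> ?I")
    case True
    have "|underS ?r x| <o ?r" by (rule card_of_underS[OF card True])
    then have "|underS ?r x| \<le>o natLeq"
      using cardSuc_ordLeq_ordLess[OF natLeq_Card_order card_of_Card_order] by blast
    moreover have "underS ?r x = {y. (y, x) \<in> ?r - Id}" by (auto simp: underS_def)
    ultimately show ?thesis by (simp add: countable_card_le_natLeq)
  next
    case False
    then have empty: "{y. (y, x) \<in> ?r - Id} = {}" by (auto simp: Field_def)
    show ?thesis unfolding empty by simp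
  qed
  have inf: "infinite ?I" using cardSuc_finite[OF natLeq_Card_order] by (simp add: Field_natLeq)
  show ?thesis
    using coherent_forests_exist[OF 1(1,3,2) sub cnt inf] card_of_Field_ordIso[OF card] by blast
qed

section \<open>Transfer to successor cardinals\<close>

definition Forall :: "('f, 'r) fm \<Rightarrow> ('f, 'r) fm" where
  "Forall \<phi> = Neg (Exists (Neg \<phi>))"

definition Or :: "('f, 'r) fm \<Rightarrow> ('f, 'r) fm \<Rightarrow> ('f, 'r) fm" where
  "Or \<phi> \<psi> = Neg (And (Neg \<phi>) (Neg \<psi>))"

definition Imp :: "('f, 'r) fm \<Rightarrow> ('f, 'r) fm \<Rightarrow> ('f, 'r) fm" where
  "Imp \<phi> \<psi> = Neg (And \<phi> (Neg \<psi>))"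

lemma sat_derived [simp]:
  "sat M e (Forall \<phi>) \<longleftrightarrow> (\<forall>a\<in>universe M. sat M (case_nat a e) \<phi>)"
  "sat M e (Or \<phi> \<psi>) \<longleftrightarrow> sat M e \<phi> \<or> sat M e \<psi>"
  "sat M e (Imp \<phi> \<psi>) \<longleftrightarrow> (sat M e \<phi> \<longrightarrow> sat M e \<psi>)"
  by (auto simp: Forall_def Or_def Imp_def)

lemma syntax_derived [simp]:
  "formula_in L (Forall \<phi>) = formula_in L \<phi>" "free_vars (Forall \<phi>) = {n. Suc n \<in> free_vars \<phi>}"
  "formula_in L (Or \<phi> \<psi>) \<longleftrightarrow> formula_in L \<phi> \<and> formula_in L \<psi>"
  "free_vars (Or \<phi> \<psi>) = free_vars \<phi> \<union> free_vars \<psi>"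
  "formula_in L (Imp \<phi> \<psi>) \<longleftrightarrow> formula_in L \<phi> \<and> formula_in L \<psi>"
  "free_vars (Imp \<phi> \<psi>) = free_vars \<phi> \<union> free_vars \<psi>"
  by (auto simp: Forall_def Or_def Imp_def)

text \<open>The relation symbols 0, 1, 2 stand for \<open>U\<close>, \<open>le\<close>,
  \<open>P\<close>, and \<open>Suc\<close> gives them arities 1, 2, 3. The function symbol 0 stands
  for \<open>lab\<close>.\<close>

definition forest_vocabulary :: "(nat, nat) vocabulary" where
  "forest_vocabulary = \<lparr>fun_syms = {0}, rel_syms = {0, 1, 2}, fun_arity = \<lambda>_. 2, rel_arity = Suc\<rparr>"

abbreviation (input) U_fm :: "nat \<Rightarrow> (nat, nat) fm" where
  "U_fm i \<equiv> Rel 0 [Var i]"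

abbreviation (input) le_fm :: "nat \<Rightarrow> nat \<Rightarrow> (nat, nat) fm" where
  "le_fm i j \<equiv> Rel 1 [Var i, Var j]"

abbreviation (input) P_fm :: "nat \<Rightarrow> nat \<Rightarrow> nat \<Rightarrow> (nat, nat) fm" where
  "P_fm n i j \<equiv> Rel 2 [Var n, Var i, Var j]"

abbreviation (input) lab_tm :: "nat \<Rightarrow> nat \<Rightarrow> nat tm" where
  "lab_tm n i \<equiv> Fn 0 [Var n, Var i]"

text \<open>The conditions follow the order of the locale; \<open>P_sub\<close> is built into the
  relation read off from a structure. The first variable of a quantifier block has the highest
  index, and a further \<open>Exists\<close> shifts all indices by one.\<close>

definition forest_axioms :: "(nat, nat) fm list" where
  "forest_axioms =
   [(Forall ^^ 3) (Imp (And (U_fm 2) (And (U_fm 1) (And (U_fm 0) (And (le_fm 2 1) (le_fm 1 0))))) (le_fm 2 0)),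
    (Forall ^^ 2) (Imp (And (U_fm 1) (U_fm 0)) (Or (le_fm 1 0) (le_fm 0 1))),
    (Forall ^^ 4) (Imp (And (U_fm 3) (And (P_fm 3 2 1) (P_fm 3 1 0))) (P_fm 3 2 0)),
    (Forall ^^ 4) (Imp (And (U_fm 3) (And (P_fm 3 2 0) (P_fm 3 1 0)))
      (Or (Eq (Var 2) (Var 1)) (Or (P_fm 3 2 1) (P_fm 3 1 2)))),
    (Forall ^^ 4) (Imp (And (U_fm 3) (And (U_fm 2) (And (le_fm 3 2) (P_fm 3 1 0)))) (P_fm 2 1 0)),
    (Forall ^^ 2) (Or (Eq (Var 1) (Var 0)) (Exists (And (U_fm 0) (Or (P_fm 0 2 1) (P_fm 0 1 2))))),
    (Forall ^^ 2) (Imp (U_fm 1) (Rel 0 [lab_tm 1 0])),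
    (Forall ^^ 3) (Imp (And (U_fm 2) (P_fm 2 1 0)) (Neg (Eq (lab_tm 2 1) (lab_tm 2 0)))),
    (Forall ^^ 4) (Imp (And (U_fm 3) (And (U_fm 2) (And (le_fm 3 2) (Eq (lab_tm 2 1) (lab_tm 2 0)))))
      (Eq (lab_tm 3 1) (lab_tm 3 0))),
    (Forall ^^ 5) (Imp (And (U_fm 4) (And (U_fm 3) (And (le_fm 4 3) (And (Eq (lab_tm 3 2) (lab_tm 3 1)) (P_fm 4 0 2)))))
      (Exists (And (P_fm 5 0 2) (Eq (lab_tm 4 0) (lab_tm 4 1)))))]"

lemma theory_in_forest_axioms: "theory_in forest_vocabulary (set forest_axioms)"
  by (simp add: theory_in_def forest_axioms_def sentence_def forest_vocabulary_def numeral_eq_Suc)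

text \<open>The right-hand side has the form to which satisfaction of \<open>forest_axioms\<close>
  unfolds, with every quantifier bounded by the universe.\<close>

lemma coherent_forests_relational_iff:
  assumes "\<And>n x. n \<in> W \<Longrightarrow> x \<in> W \<Longrightarrow> lab n x \<in> W"
  shows "coherent_forests W {a \<in> W. u a} le (\<lambda>n. {(x, y). x \<in> W \<and> y \<in> W \<and> p n x y}) lab \<longleftrightarrow>
    (\<forall>n\<in>W. \<forall>m\<in>W. \<forall>k\<in>W. u n \<and> u m \<and> u k \<and> le n m \<and> le m k \<longrightarrow> le n k) \<and>
    (\<forall>n\<in>W. \<forall>m\<in>W. u n \<and> u m \<longrightarrow> le n m \<or> le m n) \<and>
    (\<forall>n\<in>W. \<forall>x\<in>W. \<forall>y\<in>W. \<forall>z\<in>W. u n \<and> p n x y \<and> p n y z \<longrightarrow> p n x z) \<and>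
    (\<forall>n\<in>W. \<forall>x\<in>W. \<forall>y\<in>W. \<forall>z\<in>W. u n \<and> p n x z \<and> p n y z \<longrightarrow> x = y \<or> p n x y \<or> p n y x) \<and>
    (\<forall>n\<in>W. \<forall>m\<in>W. \<forall>x\<in>W. \<forall>y\<in>W. u n \<and> u m \<and> le n m \<and> p n x y \<longrightarrow> p m x y) \<and>
    (\<forall>x\<in>W. \<forall>y\<in>W. x = y \<or> (\<exists>n\<in>W. u n \<and> (p n x y \<or> p n y x))) \<and>
    (\<forall>n\<in>W. \<forall>x\<in>W. u n \<longrightarrow> u (lab n x)) \<and>
    (\<forall>n\<in>W. \<forall>x\<in>W. \<forall>y\<in>W. u n \<and> p n x y \<longrightarrow> lab n x \<noteq> lab n y) \<and>
    (\<forall>n\<in>W. \<forall>m\<in>W. \<forall>x\<in>W. \<forall>y\<in>W. u n \<and> u m \<and> le n m \<and> lab m x = lab m y \<longrightarrow> lab n x = lab n y) \<and>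
    (\<forall>n\<in>W. \<forall>m\<in>W. \<forall>x\<in>W. \<forall>y\<in>W. \<forall>x'\<in>W. u n \<and> u m \<and> le n m \<and> lab m x = lab m y \<and> p n x' x \<longrightarrow>
      (\<exists>y'\<in>W. p n y' y \<and> lab m y' = lab m x'))"
    (is "?R \<longleftrightarrow> ?L1 \<and> ?L2 \<and> ?L3 \<and> ?L4 \<and> ?L5 \<and> ?L6 \<and> ?L7 \<and> ?L8 \<and> ?L9 \<and> ?L10")
proof
  assume L: "?L1 \<and> ?L2 \<and> ?L3 \<and> ?L4 \<and> ?L5 \<and> ?L6 \<and> ?L7 \<and> ?L8 \<and> ?L9 \<and> ?L10"
  note L1 = L[THEN conjunct1]
    and L2 = L[THEN conjunct2, THEN conjunct1]
    and L3 = L[THEN conjunct2, THEN conjunct2, THEN conjunct1]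
    and L4 = L[THEN conjunct2, THEN conjunct2, THEN conjunct2, THEN conjunct1]
    and L5 = L[THEN conjunct2, THEN conjunct2, THEN conjunct2, THEN conjunct2, THEN conjunct1]
    and L6 = L[THEN conjunct2, THEN conjunct2, THEN conjunct2, THEN conjunct2, THEN conjunct2, THEN conjunct1]
    and L7 = L[THEN conjunct2, THEN conjunct2, THEN conjunct2, THEN conjunct2, THEN conjunct2, THEN conjunct2, THEN conjunct1]
    and L8 = L[THEN conjunct2, THEN conjunct2, THEN conjunct2, THEN conjunct2, THEN conjunct2, THEN conjunct2, THEN conjunct2, THEN conjunct1]
    and L9 = L[THEN conjunct2, THEN conjunct2, THEN conjunct2, THEN conjunct2, THEN conjunct2, THEN conjunct2, THEN conjunct2, THEN conjunct2, THEN conjunct1]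
    and L10 = L[THEN conjunct2, THEN conjunct2, THEN conjunct2, THEN conjunct2, THEN conjunct2, THEN conjunct2, THEN conjunct2, THEN conjunct2, THEN conjunct2]
  show ?R
  proof
    fix n m k assume "n \<in> {a \<in> W. u a}" "m \<in> {a \<in> W. u a}" "k \<in> {a \<in> W. u a}" "le n m" "le m k"
    then show "le n k" using L1 by blast
  next
    fix n m assume "n \<in> {a \<in> W. u a}" "m \<in> {a \<in> W. u a}"
    then show "le n m \<or> le m n" using L2 by blast
  next
    fix n assume "n \<in> {a \<in> W. u a}"
    then show "trans {(x, y). x \<in> W \<and> y \<in> W \<and> p n x y}" using L3 unfolding trans_def by blast
  next
    fix n x y z assume "n \<in> {a \<in> W. u a}" "(x, z) \<in> {(x, y). x \<in> W \<and> y \<in> W \<and> p n x y}"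
      "(y, z) \<in> {(x, y). x \<in> W \<and> y \<in> W \<and> p n x y}"
    then show "x = y \<or> (x, y) \<in> {(x, y). x \<in> W \<and> y \<in> W \<and> p n x y} \<or> (y, x) \<in> {(x, y). x \<in> W \<and> y \<in> W \<and> p n x y}"
      using L4 by simp blast
  next
    fix n m assume "n \<in> {a \<in> W. u a}" "m \<in> {a \<in> W. u a}" "le n m"
    then show "{(x, y). x \<in> W \<and> y \<in> W \<and> p n x y} \<subseteq> {(x, y). x \<in> W \<and> y \<in> W \<and> p m x y}" using L5 by blast
  next
    fix x y assume "x \<in> W" "y \<in> W" "x \<noteq> y"
    then show "\<exists>n\<in>{a \<in> W. u a}. (x, y) \<in> {(x, y). x \<in> W \<and> y \<in> W \<and> p n x y} \<or>
        (y, x) \<in> {(x, y). x \<in> W \<and> y \<in> W \<and> p n x y}" using L6 by simp blast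
  next
    fix n x assume "n \<in> {a \<in> W. u a}" "x \<in> W"
    then show "lab n x \<in> {a \<in> W. u a}" using L7 assms by simp
  next
    fix n x y assume "n \<in> {a \<in> W. u a}" "(x, y) \<in> {(x, y). x \<in> W \<and> y \<in> W \<and> p n x y}"
    then show "lab n x \<noteq> lab n y" using L8 by simp
  next
    fix n m x y assume "n \<in> {a \<in> W. u a}" "m \<in> {a \<in> W. u a}" "le n m" "x \<in> W" "y \<in> W" "lab m x = lab m y"
    then show "lab n x = lab n y" using L9 by blast
  next
    fix n m y x x' assume "n \<in> {a \<in> W. u a}" "m \<in> {a \<in> W. u a}" "le n m" "y \<in> W" "lab m x = lab m y"
      "(x', x) \<in> {(x, y). x \<in> W \<and> y \<in> W \<and> p n x y}"
    moreover from this have "\<exists>y'\<in>W. p n y' y \<and> lab m y' = lab m x'" using L10 by blast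
    ultimately show "\<exists>y'. (y', y) \<in> {(x, y). x \<in> W \<and> y \<in> W \<and> p n x y} \<and> lab m y' = lab m x'" by blast
  qed auto
next
  assume ?R
  then interpret coherent_forests W "{a \<in> W. u a}" le "\<lambda>n. {(x, y). x \<in> W \<and> y \<in> W \<and> p n x y}" lab .
  show "?L1 \<and> ?L2 \<and> ?L3 \<and> ?L4 \<and> ?L5 \<and> ?L6 \<and> ?L7 \<and> ?L8 \<and> ?L9 \<and> ?L10"
  proof (intro conjI ballI impI)
    fix n m k assume "n \<in> W" "m \<in> W" "k \<in> W" "u n \<and> u m \<and> u k \<and> le n m \<and> le m k"
    then show "le n k" using le_trans[of n m k] by simp
  next
    fix n m assume "n \<in> W" "m \<in> W" "u n \<and> u m"
    then show "le n m \<or> le m n" using le_total[of n m] by simp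
  next
    fix n x y z assume "n \<in> W" "x \<in> W" "y \<in> W" "z \<in> W" "u n \<and> p n x y \<and> p n y z"
    then show "p n x z" using P_trans[of n, THEN transD, of x y z] by simp
  next
    fix n x y z assume "n \<in> W" "x \<in> W" "y \<in> W" "z \<in> W" "u n \<and> p n x z \<and> p n y z"
    then show "x = y \<or> p n x y \<or> p n y x" using P_linear[of n x z y] by simp
  next
    fix n m x y assume "n \<in> W" "m \<in> W" "x \<in> W" "y \<in> W" "u n \<and> u m \<and> le n m \<and> p n x y"
    then show "p m x y" using subsetD[OF P_mono, of n m "(x, y)"] by simp
  next
    fix x y assume "x \<in> W" "y \<in> W"
    then show "x = y \<or> (\<exists>n\<in>W. u n \<and> (p n x y \<or> p n y x))" using P_cover[of x y] by auto
  next
    fix n x assume "n \<in> W" "x \<in> W" "u n"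
    then show "u (lab n x)" using lab_in[of n x] by simp
  next
    fix n x y assume "n \<in> W" "x \<in> W" "y \<in> W" "u n \<and> p n x y"
    then show "lab n x \<noteq> lab n y" using lab_neq[of n x y] by simp
  next
    fix n m x y assume "n \<in> W" "m \<in> W" "x \<in> W" "y \<in> W" "u n \<and> u m \<and> le n m \<and> lab m x = lab m y"
    then show "lab n x = lab n y" using lab_refine[of n m x y] by simp
  next
    fix n m x y x' assume "n \<in> W" "m \<in> W" "x \<in> W" "y \<in> W" "x' \<in> W"
      "u n \<and> u m \<and> le n m \<and> lab m x = lab m y \<and> p n x' x"
    then show "\<exists>y'\<in>W. p n y' y \<and> lab m y' = lab m x'" using lab_lift[of n m y x x'] by auto
  qed
qed

lemma sat_forest_axioms:
  assumes lab: "\<forall>n\<in>universe A. \<forall>x\<in>universe A. fun_int A 0 [n, x] \<in> universe A"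
  shows "(\<forall>\<phi>\<in>set forest_axioms. sat A e \<phi>) \<longleftrightarrow>
    coherent_forests (universe A) {a \<in> universe A. rel_int A 0 [a]} (\<lambda>a b. rel_int A 1 [a, b])
      (\<lambda>n. {(x, y). x \<in> universe A \<and> y \<in> universe A \<and> rel_int A 2 [n, x, y]}) (\<lambda>n x. fun_int A 0 [n, x])"
proof -
  have "(\<forall>\<phi>\<in>set forest_axioms. sat A e \<phi>) \<longleftrightarrow>
    (\<forall>n\<in>universe A. \<forall>m\<in>universe A. \<forall>k\<in>universe A. rel_int A 0 [n] \<and> rel_int A 0 [m] \<and> rel_int A 0 [k] \<and>
      rel_int A 1 [n, m] \<and> rel_int A 1 [m, k] \<longrightarrow> rel_int A 1 [n, k]) \<and>
    (\<forall>n\<in>universe A. \<forall>m\<in>universe A. rel_int A 0 [n] \<and> rel_int A 0 [m] \<longrightarrow> rel_int A 1 [n, m] \<or> rel_int A 1 [m, n]) \<and>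
    (\<forall>n\<in>universe A. \<forall>x\<in>universe A. \<forall>y\<in>universe A. \<forall>z\<in>universe A.
      rel_int A 0 [n] \<and> rel_int A 2 [n, x, y] \<and> rel_int A 2 [n, y, z] \<longrightarrow> rel_int A 2 [n, x, z]) \<and>
    (\<forall>n\<in>universe A. \<forall>x\<in>universe A. \<forall>y\<in>universe A. \<forall>z\<in>universe A.
      rel_int A 0 [n] \<and> rel_int A 2 [n, x, z] \<and> rel_int A 2 [n, y, z] \<longrightarrow>
      x = y \<or> rel_int A 2 [n, x, y] \<or> rel_int A 2 [n, y, x]) \<and>
    (\<forall>n\<in>universe A. \<forall>m\<in>universe A. \<forall>x\<in>universe A. \<forall>y\<in>universe A.
      rel_int A 0 [n] \<and> rel_int A 0 [m] \<and> rel_int A 1 [n, m] \<and> rel_int A 2 [n, x, y] \<longrightarrow> rel_int A 2 [m, x, y]) \<and>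
    (\<forall>x\<in>universe A. \<forall>y\<in>universe A. x = y \<or>
      (\<exists>n\<in>universe A. rel_int A 0 [n] \<and> (rel_int A 2 [n, x, y] \<or> rel_int A 2 [n, y, x]))) \<and>
    (\<forall>n\<in>universe A. \<forall>x\<in>universe A. rel_int A 0 [n] \<longrightarrow> rel_int A 0 [fun_int A 0 [n, x]]) \<and>
    (\<forall>n\<in>universe A. \<forall>x\<in>universe A. \<forall>y\<in>universe A. rel_int A 0 [n] \<and> rel_int A 2 [n, x, y] \<longrightarrow>
      fun_int A 0 [n, x] \<noteq> fun_int A 0 [n, y]) \<and>
    (\<forall>n\<in>universe A. \<forall>m\<in>universe A. \<forall>x\<in>universe A. \<forall>y\<in>universe A.
      rel_int A 0 [n] \<and> rel_int A 0 [m] \<and> rel_int A 1 [n, m] \<and> fun_int A 0 [m, x] = fun_int A 0 [m, y] \<longrightarrow>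
      fun_int A 0 [n, x] = fun_int A 0 [n, y]) \<and>
    (\<forall>n\<in>universe A. \<forall>m\<in>universe A. \<forall>x\<in>universe A. \<forall>y\<in>universe A. \<forall>x'\<in>universe A.
      rel_int A 0 [n] \<and> rel_int A 0 [m] \<and> rel_int A 1 [n, m] \<and> fun_int A 0 [m, x] = fun_int A 0 [m, y] \<and>
      rel_int A 2 [n, x', x] \<longrightarrow>
      (\<exists>y'\<in>universe A. rel_int A 2 [n, y', y] \<and> fun_int A 0 [m, y'] = fun_int A 0 [m, x']))"
    by (simp add: forest_axioms_def numeral_eq_Suc)
  also have "\<dots> \<longleftrightarrow> coherent_forests (universe A) {a \<in> universe A. rel_int A 0 [a]} (\<lambda>a b. rel_int A 1 [a, b])
      (\<lambda>n. {(x, y). x \<in> universe A \<and> y \<in> universe A \<and> rel_int A 2 [n, x, y]}) (\<lambda>n x. fun_int A 0 [n, x])"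
    by (rule coherent_forests_relational_iff[where p = "\<lambda>n x y. rel_int A 2 [n, x, y]", symmetric]) (use lab in blast)
  finally show ?thesis .
qed

section \<open>Application of the transfer principle\<close>

lemma coherent_forests_transfer:
  assumes "two_cardinal_transfer |UNIV :: 'i set|"
  shows "\<exists>(I :: 'i set set) U le P lab. coherent_forests I U le P lab \<and>
    |I| =o cardSuc |UNIV :: 'i set| \<and> |U| =o |UNIV :: 'i set|"
proof -
  obtain I :: "nat set set" and U le P lab where cf: "coherent_forests I U le P lab"
    and U: "U \<subseteq> I" "|U| =o natLeq" and I: "|I| =o cardSuc natLeq"
    using coherent_forests_aleph1 by blast
  interpret coherent_forests I U le P lab by (fact cf)
  have "U \<noteq> {}" using U(2) by (metis card_of_empty3 card_of_nat empty_not_UNIV ordIso_imp_ordLeq ordIso_symmetric ordLeq_transitive)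
  then obtain i0 where i0: "i0 \<in> U" by blast
  \<comment> \<open>A function symbol is interpreted on the whole universe. The default
    \<open>i0\<close> is taken from \<open>U\<close>, so that all values lie in
    \<open>U\<close>.\<close>
  define lb where "lb = (\<lambda>n x. if n \<in> U \<and> x \<in> I then lab n x else i0)"
  define A :: "(nat set, nat, nat) struct" where
    "A = \<lparr>universe = I, fun_int = \<lambda>f xs. lb (xs ! 0) (xs ! 1),
      rel_int = \<lambda>r xs. if r = 0 then xs ! 0 \<in> U else if r = 1 then le (xs ! 0) (xs ! 1) else (xs ! 1, xs ! 2) \<in> P (xs ! 0)\<rparr>"
  have lbU: "lb n x \<in> U" for n x using lab_in i0 by (simp add: lb_def)
  have uA: "universe A = I" by (simp add: A_def)
  have A_int: "rel_int A 0 [a] \<longleftrightarrow> a \<in> U" "rel_int A 1 [a, b] \<longleftrightarrow> le a b" "rel_int A 2 [a, b, c] \<longleftrightarrow> (b, c) \<in> P a"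
      "fun_int A 0 [a, b] = lb a b" for a b c
    by (simp_all add: A_def)
  have "coherent_forests I {a \<in> I. a \<in> U} le (\<lambda>n. {(x, y). x \<in> I \<and> y \<in> I \<and> (x, y) \<in> P n}) lb"
  proof -
    have 1: "{a \<in> I. a \<in> U} = U" using U(1) by blast
    have 2: "{(x, y). x \<in> I \<and> y \<in> I \<and> (x, y) \<in> P n} = P n" if "n \<in> U" for n using P_sub[OF that] by auto
    have 3: "lb n x = lab n x" if "n \<in> U" "x \<in> I" for n x using that by (simp add: lb_def)
    show ?thesis unfolding 1
    proof
      fix n m y x x' assume a: "n \<in> U" "m \<in> U" "le n m" "y \<in> I" "lb m x = lb m y"
        "(x', x) \<in> {(x, y). x \<in> I \<and> y \<in> I \<and> (x, y) \<in> P n}"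
      then have "lab m x = lab m y" "(x', x) \<in> P n" "x' \<in> I" by (simp_all add: 3)
      then obtain y' where "(y', y) \<in> P n" "lab m y' = lab m x'" using lab_lift[OF a(1-4)] by blast
      moreover have "y' \<in> I" using P_sub[OF a(1)] \<open>(y', y) \<in> P n\<close> by auto
      ultimately show "\<exists>y'. (y', y) \<in> {(x, y). x \<in> I \<and> y \<in> I \<and> (x, y) \<in> P n} \<and> lb m y' = lb m x'"
        using a(2,4) \<open>x' \<in> I\<close> by (intro exI[of _ y']) (simp add: 3)
    next
      fix n m x y assume a: "n \<in> U" "m \<in> U" "le n m" "x \<in> I" "y \<in> I" "lb m x = lb m y"
      then show "lb n x = lb n y" using lab_refine[OF a(1-5)] by (simp add: 3)
    next
      fix n x y assume a: "n \<in> U" "(x, y) \<in> {(x, y). x \<in> I \<and> y \<in> I \<and> (x, y) \<in> P n}"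
      then show "lb n x \<noteq> lb n y" using lab_neq[of n x y] by (simp add: 3)
    next
      fix n m k assume "n \<in> U" "m \<in> U" "k \<in> U" "le n m" "le m k"
      then show "le n k" by (rule le_trans)
    next
      fix n m assume "n \<in> U" "m \<in> U" "le n m"
      then show "{(x, y). x \<in> I \<and> y \<in> I \<and> (x, y) \<in> P n} \<subseteq> {(x, y). x \<in> I \<and> y \<in> I \<and> (x, y) \<in> P m}"
        using P_mono by (simp add: 2)
    qed (simp_all add: 2 le_total P_sub P_trans P_linear P_cover lbU)
  qed
  then have sat: "\<forall>\<phi>\<in>set forest_axioms. sat A e \<phi>" for e
    using lbU U(1) by (subst sat_forest_axioms) (auto simp: uA A_int A_int(2)[simplified])
  have "model_of forest_vocabulary (set forest_axioms) A"
    using sat i0 lbU U(1) by (auto simp: model_of_def structure_of_def true_in_def forest_vocabulary_def A_def)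
  moreover have "|{a \<in> universe A. rel_int A 0 [a]}| =o natLeq"
  proof -
    have "{a \<in> I. a \<in> U} = U" using U(1) by blast
    then show ?thesis using U(2) by (simp add: uA A_int)
  qed
  moreover have "|universe A| =o cardSuc natLeq" using I by (simp add: uA)
  moreover have "(0::nat) \<in> rel_syms forest_vocabulary" "rel_arity forest_vocabulary 0 = 1"
    by (simp_all add: forest_vocabulary_def)
  ultimately obtain B :: "('i set, nat, nat) struct" where B: "model_of forest_vocabulary (set forest_axioms) B"
      "|universe B| =o cardSuc |UNIV :: 'i set|" "|{b \<in> universe B. rel_int B 0 [b]}| =o |UNIV :: 'i set|"
    using assms theory_in_forest_axioms unfolding two_cardinal_transfer_def by blast
  obtain b where b: "b \<in> universe B" using B(1) by (auto simp: model_of_def structure_of_def)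
  have "\<forall>\<phi>\<in>set forest_axioms. sat B (\<lambda>_. b) \<phi>" using B(1) b by (auto simp: model_of_def true_in_def)
  moreover have "\<forall>n\<in>universe B. \<forall>x\<in>universe B. fun_int B 0 [n, x] \<in> universe B"
    using B(1) by (simp add: model_of_def structure_of_def forest_vocabulary_def)
  ultimately show ?thesis using sat_forest_axioms[of B "\<lambda>_. b"] B(2,3) by blast
qed

section \<open>The embedding\<close>

text \<open>The map \<open>a\<close> is copied along the forest to a map \<open>x\<close> into a
  finite set, which \<open>g\<close> then sends to \<open>N\<close>. Pairwise comparable points lie
  on one branch, and there the copy preserves the formulas of \<open>F\<close>.\<close>

lemma forest_approximation:
  fixes M :: "('m, 'f, 'r) struct" and a :: "'b \<Rightarrow> 'm"
  assumes M: "structure_of L M" and N: "structure_of L N"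
    and \<Delta>: "\<forall>\<phi>\<in>\<Delta>. formula_in L \<phi>"
    and trans: "\<forall>\<phi>\<in>weakly_existential \<Delta>. sentence L \<phi> \<longrightarrow> true_in M \<phi> \<longrightarrow> true_in N \<phi>"
    and F: "finite F" "F \<subseteq> \<Delta>"
    and R: "bounded_forest I H R" and a: "a \<in> I \<rightarrow> universe M"
  shows "\<exists>f. f \<in> I \<rightarrow> universe N \<and> (\<forall>\<phi>\<in>F. \<forall>e. range e \<subseteq> I \<longrightarrow>
    (\<forall>n\<in>free_vars \<phi>. \<forall>m\<in>free_vars \<phi>. e n = e m \<or> (e n, e m) \<in> R \<or> (e m, e n) \<in> R) \<longrightarrow>
    (sat M (a \<circ> e) \<phi> \<longleftrightarrow> sat N (f \<circ> e) \<phi>))"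
proof -
  let ?A = "universe M"
  have A: "?A \<noteq> {}" using M by (simp add: structure_of_def)
  define \<Sigma> where "\<Sigma> = (\<lambda>\<phi> :: ('f, 'r) fm. {\<sigma>. \<forall>n. (n \<in> free_vars \<phi> \<longrightarrow> \<sigma> n \<in> {..<H}) \<and>
    (n \<notin> free_vars \<phi> \<longrightarrow> \<sigma> n = 0)})"
  have "finite (\<Sigma> \<phi>)" for \<phi>
    unfolding \<Sigma>_def by (rule finite_set_of_finite_funs) (simp_all add: finite_free_vars)
  then have G: "finite (Sigma F \<Sigma>)" using F(1) by blast
  \<comment> \<open>What \<open>c\<close> has to remember of a tuple: which formulas of
    \<open>F\<close> hold under which placement of their free variables. There are finitely many
    such pairs, hence finitely many values of \<open>c\<close>.\<close>
  define types where "types = (\<lambda>xs. {(\<phi>, \<sigma>) \<in> Sigma F \<Sigma>. sat M (\<lambda>n. xs ! \<sigma> n) \<phi>})"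
  have types_sub: "types xs \<subseteq> Sigma F \<Sigma>" for xs by (auto simp: types_def)
  define code where "code = to_nat_on (Sigma F \<Sigma>)"
  have code: "inj_on code (Sigma F \<Sigma>)" unfolding code_def using G by (simp add: inj_on_to_nat_on countable_finite)
  define c where "c = (\<lambda>xs. set_encode (code ` types xs))"
  have c_eq: "types xs = types ys" if "c xs = c ys" for xs ys
  proof -
    have "finite (types xs)" "finite (types ys)" using types_sub G finite_subset by blast+
    then have "code ` types xs = code ` types ys" using that by (simp add: c_def set_encode_eq)
    then show ?thesis using inj_on_image_eq_iff[OF code types_sub types_sub] by blast
  qed
  have "c ` {xs. length xs = H \<and> set xs \<subseteq> ?A} \<subseteq> set_encode ` Pow (code ` Sigma F \<Sigma>)"
    using types_sub unfolding c_def by blast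
  then have "finite (c ` {xs. length xs = H \<and> set xs \<subseteq> ?A})"
    by (rule finite_subset) (simp add: G)
  from finite_forest_copy[OF this A R a] obtain X x where X: "finite X" "X \<subseteq> ?A" "x \<in> I \<rightarrow> X"
    and copy: "\<forall>z\<in>I. \<exists>zs ps qs. set zs = insert z {x. (x, z) \<in> R} \<and> length ps + length zs = H \<and>
      length qs = length ps \<and> set ps \<subseteq> ?A \<and> set qs \<subseteq> ?A \<and> c (ps @ map a zs) = c (qs @ map x zs)"
    by (elim exE conjE)
  obtain g where g: "range g \<subseteq> universe N"
      "\<And>\<phi> e. \<phi> \<in> F \<Longrightarrow> range e \<subseteq> X \<Longrightarrow> sat M e \<phi> \<longleftrightarrow> sat N (g \<circ> e) \<phi>"
    using finite_partial_map_preserving[OF M N \<Delta> trans F X(1,2)] by blast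
  have "sat M (a \<circ> e) \<phi> \<longleftrightarrow> sat N (g \<circ> x \<circ> e) \<phi>"
    if \<phi>: "\<phi> \<in> F" and e: "range e \<subseteq> I"
      and ch: "\<forall>n\<in>free_vars \<phi>. \<forall>m\<in>free_vars \<phi>. e n = e m \<or> (e n, e m) \<in> R \<or> (e m, e n) \<in> R" for \<phi> e
  proof -
    \<comment> \<open>A finite chain lies below its top; without free variables any branch
      serves.\<close>
    have "\<exists>z\<in>I. e ` free_vars \<phi> \<subseteq> insert z {x. (x, z) \<in> R}"
    proof (cases "free_vars \<phi> = {}")
      case False
      then obtain z where "z \<in> e ` free_vars \<phi>" "e ` free_vars \<phi> \<subseteq> insert z {x. (x, z) \<in> R}"
        using bounded_forest_chain_top[OF R, of "e ` free_vars \<phi>"] finite_free_vars[of \<phi>] ch by blast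
      then show ?thesis using e by blast
    qed (use e in \<open>intro bexI[of _ "e 0"], auto\<close>)
    then obtain z where z: "z \<in> I" "e ` free_vars \<phi> \<subseteq> insert z {x. (x, z) \<in> R}" by blast
    obtain zs ps qs where zs: "set zs = insert z {x. (x, z) \<in> R}" "length ps + length zs = H"
        "length qs = length ps" "c (ps @ map a zs) = c (qs @ map x zs)"
      using copy z(1) by blast
    define pos where "pos = (\<lambda>y. SOME i. i < length zs \<and> zs ! i = y)"
    have pos: "pos (e n) < length zs \<and> zs ! pos (e n) = e n" if "n \<in> free_vars \<phi>" for n
    proof -
      have "e n \<in> set zs" using that z(2) zs(1) by blast
      then show ?thesis unfolding pos_def by (intro someI_ex[of "\<lambda>i. i < length zs \<and> zs ! i = e n"]) (simp add: in_set_conv_nth)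
    qed
    \<comment> \<open>Positions in the branch are shifted by the padding, which has the same length
      on both sides.\<close>
    define \<sigma> where "\<sigma> = (\<lambda>n. if n \<in> free_vars \<phi> then length ps + pos (e n) else 0)"
    have "\<sigma> \<in> \<Sigma> \<phi>" using pos zs(2) by (auto simp: \<Sigma>_def \<sigma>_def)
    then have "(\<phi>, \<sigma>) \<in> Sigma F \<Sigma>" using \<phi> by blast
    then have eq: "sat M (\<lambda>n. (ps @ map a zs) ! \<sigma> n) \<phi> \<longleftrightarrow> sat M (\<lambda>n. (qs @ map x zs) ! \<sigma> n) \<phi>"
      using c_eq[OF zs(4)] unfolding types_def by blast
    have "sat M (a \<circ> e) \<phi> \<longleftrightarrow> sat M (\<lambda>n. (ps @ map a zs) ! \<sigma> n) \<phi>"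
      by (rule sat_cong) (use pos in \<open>simp add: \<sigma>_def nth_append\<close>)
    also have "\<dots> \<longleftrightarrow> sat M (x \<circ> e) \<phi>"
      unfolding eq by (rule sat_cong) (use pos zs(3) in \<open>simp add: \<sigma>_def nth_append\<close>)
    also have "\<dots> \<longleftrightarrow> sat N (g \<circ> (x \<circ> e)) \<phi>"
      by (rule g(2)[OF \<phi>]) (use e X(3) in auto)
    finally show ?thesis by (simp add: o_assoc)
  qed
  moreover have "g \<circ> x \<in> I \<rightarrow> universe N" using g(1) by auto
  ultimately show ?thesis by (intro exI[of _ "g \<circ> x"]) blast
qed

section \<open>Coding formulas by indices\<close>

text \<open>The codes lie in the index type because the family witnessing regularity is indexed by
  it. They are built from a pairing \<open>p\<close>, distinct tags \<open>k n\<close> and codes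
  \<open>q\<close>, \<open>r\<close> of the symbols.\<close>

primrec list_code :: "('i \<Rightarrow> 'i \<Rightarrow> 'i) \<Rightarrow> (nat \<Rightarrow> 'i) \<Rightarrow> 'i list \<Rightarrow> 'i" where
  "list_code p k [] = p (k 0) (k 0)"
| "list_code p k (x # xs) = p (k 1) (p x (list_code p k xs))"

primrec term_code :: "('i \<Rightarrow> 'i \<Rightarrow> 'i) \<Rightarrow> (nat \<Rightarrow> 'i) \<Rightarrow> ('f \<Rightarrow> 'i) \<Rightarrow> 'f tm \<Rightarrow> 'i" where
  "term_code p k q (Var n) = p (k 0) (k n)"
| "term_code p k q (Fn f ts) = p (k 1) (p (q f) (list_code p k (map (term_code p k q) ts)))"

primrec formula_code ::
    "('i \<Rightarrow> 'i \<Rightarrow> 'i) \<Rightarrow> (nat \<Rightarrow> 'i) \<Rightarrow> ('f \<Rightarrow> 'i) \<Rightarrow> ('r \<Rightarrow> 'i) \<Rightarrow> ('f, 'r) fm \<Rightarrow> 'i" where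
  "formula_code p k q r (Eq s t) = p (k 0) (p (term_code p k q s) (term_code p k q t))"
| "formula_code p k q r (Rel R ts) = p (k 1) (p (r R) (list_code p k (map (term_code p k q) ts)))"
| "formula_code p k q r (Neg \<phi>) = p (k 2) (formula_code p k q r \<phi>)"
| "formula_code p k q r (And \<phi> \<psi>) = p (k 3) (p (formula_code p k q r \<phi>) (formula_code p k q r \<psi>))"
| "formula_code p k q r (Exists \<phi>) = p (k 4) (formula_code p k q r \<phi>)"

context
  fixes p :: "'i \<Rightarrow> 'i \<Rightarrow> 'i" and k :: "nat \<Rightarrow> 'i" and q :: "'f \<Rightarrow> 'i" and r :: "'r \<Rightarrow> 'i"
    and L :: "('f, 'r) vocabulary"
  assumes p: "p x y = p x' y' \<longleftrightarrow> x = x' \<and> y = y'" and k: "k m = k n \<longleftrightarrow> m = n"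
    and q: "inj_on q (fun_syms L)" and r: "inj_on r (rel_syms L)"
begin

lemma list_code_eq: "list_code p k xs = list_code p k ys \<longleftrightarrow> xs = ys"
proof (induction xs arbitrary: ys)
  case Nil
  show ?case by (cases ys) (simp_all add: p k)
next
  case (Cons x xs)
  then show ?case by (cases ys) (simp_all add: p k)
qed

lemma term_code_inj: "term_in L s \<Longrightarrow> term_in L t \<Longrightarrow> term_code p k q s = term_code p k q t \<Longrightarrow> s = t"
proof (induction s arbitrary: t)
  case (Var n)
  then show ?case by (cases t) (simp_all add: p k)
next
  case (Fn f ss)
  show ?case
  proof (cases t)
    case (Fn g ts)
    with Fn.prems have g: "q f = q g" "f \<in> fun_syms L" "g \<in> fun_syms L"
      and eq: "map (term_code p k q) ss = map (term_code p k q) ts"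
      by (simp_all add: p list_code_eq)
    have len: "length ss = length ts" using eq by (rule map_eq_imp_length_eq)
    have "ss = ts"
    proof (rule nth_equalityI[OF len])
      fix i assume i: "i < length ss"
      have "term_code p k q (ss ! i) = term_code p k q (ts ! i)"
        using arg_cong[OF eq, of "\<lambda>xs. xs ! i"] i len by simp
      moreover have "term_in L (ss ! i)" "term_in L (ts ! i)"
        using Fn.prems(1,2) i len unfolding Fn by (simp_all add: list_all_length)
      ultimately show "ss ! i = ts ! i" using Fn.IH[OF nth_mem[OF i]] by blast
    qed
    then show ?thesis using g q Fn by (auto dest: inj_onD)
  qed (use Fn.prems in \<open>simp add: p k\<close>)
qed

lemma formula_code_inj: "formula_in L \<phi> \<Longrightarrow> formula_in L \<psi> \<Longrightarrow>
  formula_code p k q r \<phi> = formula_code p k q r \<psi> \<Longrightarrow> \<phi> = \<psi>"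
proof (induction \<phi> arbitrary: \<psi>)
  case (Eq s t)
  then show ?case by (cases \<psi>) (auto simp: p k dest: term_code_inj)
next
  case (Rel R ss)
  show ?case
  proof (cases \<psi>)
    case (Rel S ts)
    with Rel.prems have g: "r R = r S" "R \<in> rel_syms L" "S \<in> rel_syms L"
      and eq: "map (term_code p k q) ss = map (term_code p k q) ts"
      and "\<forall>t\<in>set ss. term_in L t" "\<forall>t\<in>set ts. term_in L t"
      by (simp_all add: p list_code_eq)
    then have "inj_on (term_code p k q) (set ss \<union> set ts)" by (auto intro!: inj_onI term_code_inj)
    then have "ss = ts" using eq by (simp add: inj_on_map_eq_map)
    then show ?thesis using g r Rel by (auto dest: inj_onD)
  qed (use Rel.prems in \<open>simp_all add: p k\<close>)
next
  case (Neg \<phi>)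
  then show ?case by (cases \<psi>) (simp_all add: p k)
next
  case (And \<phi>1 \<phi>2)
  then show ?case by (cases \<psi>) (simp_all add: p k)
next
  case (Exists \<phi>)
  then show ?case by (cases \<psi>) (simp_all add: p k)
qed

end

text \<open>An infinite type has an injective pairing and contains a copy of the natural numbers.
  Injectivity is confined to formulas of \<open>L\<close>, since the types of symbols may be larger
  than the index type.\<close>

lemma formulas_injection:
  fixes L :: "('f, 'r) vocabulary"
  assumes inf: "infinite (UNIV :: 'i set)" and L: "|fun_syms L <+> rel_syms L| \<le>o |UNIV :: 'i set|"
  shows "\<exists>k :: ('f, 'r) fm \<Rightarrow> 'i. inj_on k {\<phi>. formula_in L \<phi>}"
proof -
  obtain s :: "'f + 'r \<Rightarrow> 'i" where s: "inj_on s (fun_syms L <+> rel_syms L)"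
    using L unfolding card_of_ordLeq[symmetric] by blast
  obtain k :: "nat \<Rightarrow> 'i" where k: "inj k" using infinite_countable_subset[OF inf] by blast
  have "|(UNIV :: 'i set) \<times> (UNIV :: 'i set)| \<le>o |UNIV :: 'i set|"
    using card_of_Times_same_infinite[OF inf] ordIso_imp_ordLeq by blast
  then obtain p :: "'i \<times> 'i \<Rightarrow> 'i" where p: "inj_on p (UNIV \<times> UNIV)"
    unfolding card_of_ordLeq[symmetric] by blast
  have "inj_on (formula_code (curry p) k (s \<circ> Inl) (s \<circ> Inr)) {\<phi>. formula_in L \<phi>}"
  proof (rule inj_onI)
    fix \<phi> \<psi> assume "\<phi> \<in> {\<phi>. formula_in L \<phi>}" "\<psi> \<in> {\<phi>. formula_in L \<phi>}"
      "formula_code (curry p) k (s \<circ> Inl) (s \<circ> Inr) \<phi> = formula_code (curry p) k (s \<circ> Inl) (s \<circ> Inr) \<psi>"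
    then show "\<phi> = \<psi>"
    proof (intro formula_code_inj[of "curry p" k "s \<circ> Inl" L "s \<circ> Inr"])
      show "curry p x y = curry p x' y' \<longleftrightarrow> x = x' \<and> y = y'" for x y x' y'
        using p by (auto dest: inj_onD)
      show "k m = k n \<longleftrightarrow> m = n" for m n using k by (simp add: inj_eq)
      show "inj_on (s \<circ> Inl) (fun_syms L)" "inj_on (s \<circ> Inr) (rel_syms L)"
        using s by (auto simp: inj_on_def)
    qed simp_all
  qed
  then show ?thesis by blast
qed

section \<open>Approximations for all indices and the embedding\<close>

theorem theorem1:
  fixes L :: "('f, 'r) vocabulary"
    and T \<Delta> :: "('f, 'r) fm set"
    and M :: "('m, 'f, 'r) struct"
    and N :: "('n, 'f, 'r) struct"
    and D :: "'i filter"
  assumes "infinite (UNIV :: 'i set)"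
    and "two_cardinal_transfer |UNIV :: 'i set|"
    and "|fun_syms L <+> rel_syms L| \<le>o |UNIV :: 'i set|"
    and "theory_in L T" and "model_of L T M"
    and "|universe M| \<le>o cardSuc |UNIV :: 'i set|"
    and "structure_of L N"
    and "\<forall>\<phi>\<in>\<Delta>. formula_in L \<phi>"
    and "D \<noteq> bot" and "regular_filter D"
    and "\<forall>\<phi>\<in>weakly_existential \<Delta>. sentence L \<phi> \<longrightarrow> true_in M \<phi> \<longrightarrow> true_in N \<phi>"
  shows "\<exists>h.
    delta_embedding \<Delta> (universe M) (sat M) (universe (reduced_power D N)) (ae_sat D N) h \<and>
    delta_embedding (\<Delta> \<inter> los_formulas D N) (universe M) (sat M)
      (universe (reduced_power D N)) (sat (reduced_power D N)) h"
proof -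
  have M: "structure_of L M" using assms(5) by (simp add: model_of_def)
  obtain I :: "'i set set" and U le P lab where cf: "coherent_forests I U le P lab"
    and I: "|I| =o cardSuc |UNIV :: 'i set|" and U: "|U| =o |UNIV :: 'i set|"
    using coherent_forests_transfer[OF assms(2)] by blast
  interpret coherent_forests I U le P lab by (fact cf)
  have "|universe M| \<le>o |I|" using assms(6) I ordLeq_ordIso_trans ordIso_symmetric by blast
  then obtain j where j: "inj_on j (universe M)" "j ` universe M \<subseteq> I"
    unfolding card_of_ordLeq[symmetric] by blast
  obtain m0 where m0: "m0 \<in> universe M" using M by (auto simp: structure_of_def)
  \<comment> \<open>The points of \<open>I\<close> index \<open>M\<close>: \<open>a\<close> inverts
    \<open>j\<close>, with default \<open>m0\<close> outside the image of \<open>j\<close>.\<close>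
  define a where "a = (\<lambda>z. if z \<in> j ` universe M then inv_into (universe M) j z else m0)"
  have a: "a \<in> I \<rightarrow> universe M" using m0 by (auto simp: a_def inv_into_into)
  have aj: "a (j m) = m" if "m \<in> universe M" for m using that j(1) by (simp add: a_def)
  obtain \<gamma> where \<gamma>: "bij_betw \<gamma> U (UNIV :: 'i set)" using U unfolding card_of_ordIso[symmetric] by blast
  obtain k :: "('f, 'r) fm \<Rightarrow> 'i" where k: "inj_on k {\<phi>. formula_in L \<phi>}"
    using formulas_injection[OF assms(1,3)] by blast
  obtain A :: "'i \<Rightarrow> 'i set" where A: "\<And>\<alpha>. eventually (\<lambda>i. i \<in> A \<alpha>) D" "\<And>i. finite {\<alpha>. i \<in> A \<alpha>}"
    using assms(10) unfolding regular_filter_def by blast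
  \<comment> \<open>The regular family is used twice, through the codes of formulas and through the
    bijection \<open>\<gamma>\<close>. An index lies in only finitely many of its sets, so
    \<open>F i\<close> and \<open>S i\<close> are finite.\<close>
  define F where "F = (\<lambda>i. {\<phi>\<in>\<Delta>. i \<in> A (k \<phi>)})"
  define S where "S = (\<lambda>i. {u\<in>U. i \<in> A (\<gamma> u)})"
  have F: "finite (F i)" "F i \<subseteq> \<Delta>" for i
  proof -
    have "inj_on k (F i)" by (rule inj_on_subset[OF k]) (use assms(8) in \<open>auto simp: F_def\<close>)
    moreover have "finite (k ` F i)" by (rule finite_subset[OF _ A(2)[of i]]) (auto simp: F_def)
    ultimately show "finite (F i)" by (rule finite_imageD[rotated])
  qed (auto simp: F_def)
  have S: "finite (S i)" "S i \<subseteq> U" for i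
  proof -
    have "inj_on \<gamma> (S i)" by (rule inj_on_subset[OF bij_betw_imp_inj_on[OF \<gamma>]]) (auto simp: S_def)
    moreover have "finite (\<gamma> ` S i)" by (rule finite_subset[OF _ A(2)[of i]]) (auto simp: S_def)
    ultimately show "finite (S i)" by (rule finite_imageD[rotated])
  qed (auto simp: S_def)
  \<comment> \<open>This does not mention the forest chosen for \<open>i\<close>, so it can be
    verified almost everywhere from membership in \<open>S i\<close>.\<close>
  define linked where "linked = (\<lambda>i x y. \<exists>n\<in>S i. (x, y) \<in> P n \<and> lab n x \<in> S i \<and> lab n y \<in> S i)"
  have "\<exists>f. f \<in> I \<rightarrow> universe N \<and> (\<forall>\<phi>\<in>F i. \<forall>e. range e \<subseteq> I \<longrightarrow>
      (\<forall>n\<in>free_vars \<phi>. \<forall>m\<in>free_vars \<phi>. e n = e m \<or> linked i (e n) (e m) \<or> linked i (e m) (e n)) \<longrightarrow>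
      (sat M (a \<circ> e) \<phi> \<longleftrightarrow> sat N (f \<circ> e) \<phi>))" for i
  proof -
    \<comment> \<open>Stages and labels are both elements of \<open>U\<close>, so \<open>S i\<close>
      serves in both roles.\<close>
    obtain H R where "stage_forest (S i) (S i) H R" using stage_forest_exists[OF S(1) S] by blast
    note R = stage_forestD(1,2)[OF this]
    have lR: "(x, y) \<in> R" if "linked i x y" for x y using that R(2) by (auto simp: linked_def)
    from forest_approximation[OF M assms(7,8,11) F[of i] R(1) a]
    obtain f where f: "f \<in> I \<rightarrow> universe N" "\<forall>\<phi>\<in>F i. \<forall>e. range e \<subseteq> I \<longrightarrow>
        (\<forall>n\<in>free_vars \<phi>. \<forall>m\<in>free_vars \<phi>. e n = e m \<or> (e n, e m) \<in> R \<or> (e m, e n) \<in> R) \<longrightarrow>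
        (sat M (a \<circ> e) \<phi> \<longleftrightarrow> sat N (f \<circ> e) \<phi>)"
      by (elim exE conjE)
    show ?thesis
    proof (intro exI conjI ballI allI impI)
      show "f \<in> I \<rightarrow> universe N" by (fact f(1))
      fix \<phi> e assume \<phi>: "\<phi> \<in> F i" "range e \<subseteq> I"
        and "\<forall>n\<in>free_vars \<phi>. \<forall>m\<in>free_vars \<phi>. e n = e m \<or> linked i (e n) (e m) \<or> linked i (e m) (e n)"
      then have "\<forall>n\<in>free_vars \<phi>. \<forall>m\<in>free_vars \<phi>. e n = e m \<or> (e n, e m) \<in> R \<or> (e m, e n) \<in> R"
        using lR by blast
      with \<phi> show "sat M (a \<circ> e) \<phi> \<longleftrightarrow> sat N (f \<circ> e) \<phi>"
        by (rule f(2)[THEN bspec, THEN spec, THEN mp, THEN mp])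
    qed
  qed
  then have "\<forall>i. \<exists>f. f \<in> I \<rightarrow> universe N \<and> (\<forall>\<phi>\<in>F i. \<forall>e. range e \<subseteq> I \<longrightarrow>
      (\<forall>n\<in>free_vars \<phi>. \<forall>m\<in>free_vars \<phi>. e n = e m \<or> linked i (e n) (e m) \<or> linked i (e m) (e n)) \<longrightarrow>
      (sat M (a \<circ> e) \<phi> \<longleftrightarrow> sat N (f \<circ> e) \<phi>))" by (rule allI)
  from choice[OF this] obtain f where f_all: "\<forall>i. f i \<in> I \<rightarrow> universe N \<and> (\<forall>\<phi>\<in>F i. \<forall>e. range e \<subseteq> I \<longrightarrow>
      (\<forall>n\<in>free_vars \<phi>. \<forall>m\<in>free_vars \<phi>. e n = e m \<or> linked i (e n) (e m) \<or> linked i (e m) (e n)) \<longrightarrow>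
      (sat M (a \<circ> e) \<phi> \<longleftrightarrow> sat N (f i \<circ> e) \<phi>))" by (elim exE)
  note f = f_all[THEN spec, THEN conjunct1]
  note f_sat = f_all[THEN spec, THEN conjunct2, THEN bspec, THEN spec, THEN mp, THEN mp]
  let ?R = "reduced_power D N"
  define h where "h = (\<lambda>m. ae_eq D (universe N) `` {\<lambda>i. f i (j m)})"
  have fj: "f i (j m) \<in> universe N" if "m \<in> universe M" for i m using f[of i] j(2) that by auto
  have h: "h m \<in> universe ?R" and h_rep: "eventually (\<lambda>i. rep (h m) i = f i (j m)) D" if "m \<in> universe M" for m
    unfolding h_def using class_in[of "\<lambda>i. f i (j m)" N D] fj[OF that] by blast+
  have ev_S: "eventually (\<lambda>i. u \<in> S i) D" if "u \<in> U" for u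
    using A(1)[of "\<gamma> u"] that by (simp add: S_def)
  \<comment> \<open>Some stage compares \<open>x\<close> and \<open>y\<close>; this stage and the
    two labels belong to \<open>S i\<close> for almost all \<open>i\<close>.\<close>
  have ev_linked: "eventually (\<lambda>i. x = y \<or> linked i x y \<or> linked i y x) D" if xy: "x \<in> I" "y \<in> I" for x y
  proof (cases "x = y")
    case False
    obtain n where n: "n \<in> U" "(x, y) \<in> P n \<or> (y, x) \<in> P n" using P_cover[OF xy False] by blast
    show ?thesis
      using ev_S[OF n(1)] ev_S[OF lab_in[OF n(1) xy(1)]] ev_S[OF lab_in[OF n(1) xy(2)]]
      by eventually_elim (use n in \<open>auto simp: linked_def\<close>)
  qed simp
  \<comment> \<open>Almost everywhere \<open>F i\<close> contains \<open>\<phi>\<close>, the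
    relevant points are pairwise linked, and the representatives agree with \<open>f i\<close>. The
    last two conditions hold simultaneously because there are only finitely many free
    variables.\<close>
  have key: "eventually (\<lambda>i. sat M e \<phi> \<longleftrightarrow> sat N (\<lambda>n. rep ((h \<circ> e) n) i) \<phi>) D"
    if \<phi>: "\<phi> \<in> \<Delta>" and e: "range e \<subseteq> universe M" for \<phi> e
  proof -
    have eM: "e n \<in> universe M" for n using e by blast
    have jI: "range (j \<circ> e) \<subseteq> I" using j(2) eM by auto
    have "eventually (\<lambda>i. \<phi> \<in> F i) D" using A(1)[of "k \<phi>"] \<phi> by (simp add: F_def)
    moreover have "eventually (\<lambda>i. \<forall>n\<in>free_vars \<phi>. \<forall>m\<in>free_vars \<phi>.
        (j \<circ> e) n = (j \<circ> e) m \<or> linked i ((j \<circ> e) n) ((j \<circ> e) m) \<or> linked i ((j \<circ> e) m) ((j \<circ> e) n)) D"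
      by (intro eventually_ball_finite ballI finite_free_vars ev_linked) (use jI in auto)
    moreover have "eventually (\<lambda>i. \<forall>n\<in>free_vars \<phi>. rep (h (e n)) i = f i (j (e n))) D"
      by (intro eventually_ball_finite ballI finite_free_vars h_rep eM)
    ultimately show ?thesis
    proof eventually_elim
      case (elim i)
      have "sat M e \<phi> \<longleftrightarrow> sat M (a \<circ> (j \<circ> e)) \<phi>" by (rule sat_cong) (simp add: aj eM)
      also have "\<dots> \<longleftrightarrow> sat N (f i \<circ> (j \<circ> e)) \<phi>" by (rule f_sat[OF elim(1) jI elim(2)])
      also have "\<dots> \<longleftrightarrow> sat N (\<lambda>n. rep ((h \<circ> e) n) i) \<phi>" by (rule sat_cong) (use elim(3) in simp)
      finally show ?case .
    qed
  qed
  have ae: "ae_sat D N (h \<circ> e) \<phi>" if "sat M e \<phi>" "\<phi> \<in> \<Delta> \<union> Neg ` \<Delta>" "range e \<subseteq> universe M" for \<phi> e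
    using that(2)
  proof
    assume "\<phi> \<in> \<Delta>"
    from key[OF this that(3)] show ?thesis
      unfolding ae_sat_def by eventually_elim (use that(1) in blast)
  next
    assume "\<phi> \<in> Neg ` \<Delta>"
    then obtain \<psi> where \<psi>: "\<psi> \<in> \<Delta>" "\<phi> = Neg \<psi>" by blast
    from key[OF \<psi>(1) that(3)] show ?thesis
      unfolding ae_sat_def \<psi>(2) by eventually_elim (use that(1) \<psi>(2) in simp)
  qed
  have hR: "range (h \<circ> e) \<subseteq> universe ?R" if "range e \<subseteq> universe M" for e using that h by auto
  have "delta_embedding \<Delta> (universe M) (sat M) (universe ?R) (ae_sat D N) h"
    unfolding delta_embedding_def delta_homomorphism_def using h ae by auto
  moreover have "delta_embedding (\<Delta> \<inter> los_formulas D N) (universe M) (sat M) (universe ?R) (sat ?R) h"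
  proof -
    \<comment> \<open>For these formulas and their negations, truth almost everywhere passes to the
      quotient structure.\<close>
    have "sat ?R (h \<circ> e) \<phi>" if \<phi>: "\<phi> \<in> (\<Delta> \<inter> los_formulas D N) \<union> Neg ` (\<Delta> \<inter> los_formulas D N)"
      and e: "range e \<subseteq> universe M" "sat M e \<phi>" for \<phi> e
    proof -
      have "transfers D N \<phi>" using \<phi> by (auto simp: los_formulas_def)
      moreover have "ae_sat D N (h \<circ> e) \<phi>" using \<phi> by (intro ae[OF e(2) _ e(1)]) blast
      ultimately show ?thesis using hR[OF e(1)] unfolding transfers_def by blast
    qed
    then show ?thesis
      unfolding delta_embedding_def delta_homomorphism_def using h by (simp del: sat.simps)
  qed
  ultimately show ?thesis by blast
qed

end
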